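(* For any $\epsilon>0$ and $\sigma>0$ there exists an initial datum $a_0$ with $\int_{-\pi}^\pi a_0(x)dx=0$ and $$\|a_0-\cos(\cdot)\|_{C^{2-\epsilon}([-\pi,\pi])}\le\sigma$$ such that for every $\mu\in\mathbb R\setminus\{0\}$ there is no global-in-time solution $a$ of $$\partial_t a+\Big(\int_{-\pi}^x a(t,\bar x)\,d\bar x\Big)\partial_x a-a^2+\frac1\pi\int_{-\pi}^{\pi}a^2\,dx=0,\qquad x\in[-\pi,\pi],$$ with $\int_{-\pi}^\pi a(t,x)dx=0$ and $a(0,\cdot)=a_0$, satisfying $\|a(t,\cdot)-\mu\cos(\cdot)\|_{L^\infty([-\pi,\pi])}\to0$ as $t\to\infty$.
   Context: $C^{2-\epsilon}$ denotes the Hölder space of that order on $[-\pi,\pi]$. *)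

theory Defs
  imports "HOL-Analysis.Analysis"
begin

text \<open>Hoelder space C^s on [-pi,pi]. Convention: k = floor s (0 if s < 0),
  alpha = s - k in [0,1) (alpha = 0 if s < 0). The norm is
  sum_{j<=k} sup |f^(j)| + sup_{x<>y} |f^(k) x - f^(k) y| / |x-y|^alpha,
  derivatives taken (one-sidedly at the endpoints) within [-pi,pi].
  hoelder_norm_le s f c  means: f lies in C^s([-pi,pi]) and its norm is <= c.\<close>

definition hoelder_order :: "real \<Rightarrow> nat" where
  "hoelder_order s = nat \<lfloor>s\<rfloor>"

definition hoelder_exponent :: "real \<Rightarrow> real" where
  "hoelder_exponent s = max 0 (s - real (hoelder_order s))"

definition hoelder_norm_le :: "real \<Rightarrow> (real \<Rightarrow> real) \<Rightarrow> real \<Rightarrow> bool" where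
  "hoelder_norm_le s f c \<longleftrightarrow>
     (let k = hoelder_order s; \<alpha> = hoelder_exponent s in
      \<exists>D :: nat \<Rightarrow> real \<Rightarrow> real. \<exists>M :: nat \<Rightarrow> real. \<exists>H :: real.
        (\<forall>x\<in>{-pi..pi}. D 0 x = f x) \<and>
        (\<forall>j<k. \<forall>x\<in>{-pi..pi}. (D j has_real_derivative D (Suc j) x) (at x within {-pi..pi})) \<and>
        continuous_on {-pi..pi} (D k) \<and>
        (\<forall>j\<le>k. \<forall>x\<in>{-pi..pi}. \<bar>D j x\<bar> \<le> M j) \<and>
        (\<forall>x\<in>{-pi..pi}. \<forall>y\<in>{-pi..pi}. x \<noteq> y \<longrightarrow>
            \<bar>D k x - D k y\<bar> \<le> H * \<bar>x - y\<bar> powr \<alpha>) \<and>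
        (\<Sum>j\<le>k. M j) + H \<le> c)"

definition global_solution :: "(real \<Rightarrow> real \<Rightarrow> real) \<Rightarrow> (real \<Rightarrow> real) \<Rightarrow> bool" where
  "global_solution a a0 \<longleftrightarrow>
     continuous_on ({0..} \<times> {-pi..pi}) (\<lambda>(t, x). a t x) \<and>
     (\<forall>x\<in>{-pi..pi}. a 0 x = a0 x) \<and>
     (\<forall>t\<ge>0. integral {-pi..pi} (a t) = 0) \<and>
     (\<forall>t>0. \<forall>x\<in>{-pi..pi}. \<exists>dt dx.
        ((\<lambda>s. a s x) has_real_derivative dt) (at t) \<and>
        (a t has_real_derivative dx) (at x within {-pi..pi}) \<and>
        dt + integral {-pi..x} (a t) * dx - (a t x)\<^sup>2
           + (1 / pi) * integral {-pi..pi} (\<lambda>y. (a t y)\<^sup>2) = 0)"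

end

theory Submission
  imports Defs
begin

text \<open>The datum is \<open>a0 x = cos x + k * (m - \<bar>x\<bar> powr \<beta>)\<close> with \<open>2 - \<epsilon> \<le> \<beta> < 2\<close>.
  Let \<open>u t x\<close> be the integral of \<open>a t\<close> over \<open>[-pi, x]\<close>. Along characteristics \<open>\<phi>' = u t \<phi>\<close>, the
  difference \<open>w\<close> of two values of \<open>a\<close> satisfies \<open>w' = (a + b) * w\<close> (\<open>a\<close>, \<open>b\<close> the two values),
  so their order is preserved: \<open>a t\<close> keeps its minimum at \<open>-pi\<close>, which excludes \<open>\<mu> < 0\<close>, and its
  maximum on the characteristic \<open>p\<close> issued from 0. If \<open>a t\<close> tends to \<open>\<mu> * cos\<close> with \<open>\<mu> > 0\<close>, then \<open>p\<close>
  ends up near 0, and the distance \<open>z\<close> from \<open>p\<close> to a nearby characteristic grows like \<open>exp (\<mu> t)\<close>, while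
  the corresponding difference \<open>w\<close> grows like \<open>exp (2 \<mu> t)\<close>. Initially \<open>w \<ge> k * z powr \<beta>\<close>
  with \<open>\<beta> < 2\<close>; when \<open>z\<close> has reached a fixed size, \<open>w\<close> is therefore arbitrarily large if \<open>z\<close> started
  small enough, which contradicts the boundedness of \<open>a\<close>.\<close>

section \<open>Transport along characteristics\<close>

text \<open>One-sided, because in \<open>transport_le\<close> the maximum may be attained at the
  final time, where only this inequality survives.\<close>

lemma has_real_derivative_nonneg_if_max_left:
  fixes f :: "real \<Rightarrow> real"
  assumes "(f has_real_derivative D) (at x within {l..r})" "l < x" "x \<le> r"
    and "\<And>y. y \<in> {l..r} \<Longrightarrow> f y \<le> f x"
  shows "D \<ge> 0"
proof (rule ccontr)
  assume "\<not> D \<ge> 0"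
  then obtain d where d: "d > 0" "\<And>h. h > 0 \<Longrightarrow> x - h \<in> {l..r} \<Longrightarrow> h < d \<Longrightarrow> f x < f (x - h)"
    using has_real_derivative_neg_dec_left[OF assms(1)] by auto
  have "f x < f (x - min (d/2) (x - l))"
    using assms d(1) by (intro d(2)) (auto simp: min_def)
  moreover have "f (x - min (d/2) (x - l)) \<le> f x"
    using assms(2,3) d(1) by (intro assms(4)) auto
  ultimately show False by simp
qed

lemma has_real_derivative_nonpos_if_max_right:
  fixes f :: "real \<Rightarrow> real"
  assumes "(f has_real_derivative D) (at x within {l..r})" "l \<le> x" "x < r"
    and "\<And>y. y \<in> {l..r} \<Longrightarrow> f y \<le> f x"
  shows "D \<le> 0"
proof (rule ccontr)
  assume "\<not> D \<le> 0"
  then obtain d where d: "d > 0" "\<And>h. h > 0 \<Longrightarrow> x + h \<in> {l..r} \<Longrightarrow> h < d \<Longrightarrow> f x < f (x + h)"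
    using has_real_derivative_pos_inc_right[OF assms(1)] by auto
  have "f x < f (x + min (d/2) (r - x))"
    using assms d(1) by (intro d(2)) (auto simp: min_def)
  moreover have "f (x + min (d/2) (r - x)) \<le> f x"
    using assms(2,3) d(1) by (intro assms(4)) auto
  ultimately show False by simp
qed

lemma continuous_on_compose_curve:
  assumes "continuous_on (A \<times> B) (\<lambda>(t, x). f t x)" "continuous_on A \<phi>" "\<And>t. t \<in> A \<Longrightarrow> \<phi> t \<in> B"
  shows "continuous_on A (\<lambda>t. f t (\<phi> t))"
proof -
  have "continuous_on A (\<lambda>t. (\<lambda>(t, x). f t x) (t, \<phi> t))"
    by (rule continuous_on_compose2[OF assms(1)]) (use assms in \<open>auto intro!: continuous_intros\<close>)
  then show ?thesis by simp
qed

text \<open>Since only the partial derivatives of \<open>f\<close> exist, the chain rule along \<open>\<phi>\<close> is not available.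
  It is replaced by the viscosity argument of maximising \<open>f t x - h t - N * (x - \<phi> t)\<^sup>2\<close> for large \<open>N\<close>:
  at a maximum point both partial derivatives are known, and the penalty terms cancel up to the
  Lipschitz error of \<open>u\<close>.\<close>

lemma transport_le:
  fixes f g u :: "real \<Rightarrow> real \<Rightarrow> real"
  assumes le: "t1 \<le> t2"
    and f: "continuous_on ({t1..t2} \<times> {l..r}) (\<lambda>(t, x). f t x)"
    and g: "continuous_on ({t1..t2} \<times> {l..r}) (\<lambda>(t, x). g t x)"
    and pde: "\<And>t x. t1 < t \<Longrightarrow> t \<le> t2 \<Longrightarrow> x \<in> {l..r} \<Longrightarrow> \<exists>ft fx.
        ((\<lambda>s. f s x) has_real_derivative ft) (at t) \<and>
        (f t has_real_derivative fx) (at x within {l..r}) \<and> ft + u t x * fx = g t x"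
    and bdry: "\<And>t. t \<in> {t1..t2} \<Longrightarrow> u t l = 0" "\<And>t. t \<in> {t1..t2} \<Longrightarrow> u t r = 0"
    and lip: "L \<ge> 0" "\<And>t x y. t \<in> {t1..t2} \<Longrightarrow> x \<in> {l..r} \<Longrightarrow> y \<in> {l..r} \<Longrightarrow>
        \<bar>u t x - u t y\<bar> \<le> L * \<bar>x - y\<bar>"
    and \<phi>: "\<And>t. t \<in> {t1..t2} \<Longrightarrow> \<phi> t \<in> {l..r}"
      "\<And>t. t \<in> {t1..t2} \<Longrightarrow> (\<phi> has_real_derivative u t (\<phi> t)) (at t within {t1..t2})"
  shows "f t2 (\<phi> t2) - f t1 (\<phi> t1) \<le> integral {t1..t2} (\<lambda>s. g s (\<phi> s))"
proof (cases "t1 = t2")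
  case False
  with le have lt: "t1 < t2" by simp
  define gap where "gap = f t2 (\<phi> t2) - f t1 (\<phi> t1) - integral {t1..t2} (\<lambda>s. g s (\<phi> s))"
  have "\<not> gap > 0"
  proof
    assume gap: "gap > 0"
    \<comment> \<open>Adding slope \<open>\<delta>\<close> to \<open>h\<close> uses up half of
      \<open>gap\<close> over \<open>{t1..t2}\<close>. The error \<open>\<epsilon>\<close> is small
      enough to contradict \<open>\<delta> \<le> 2 * L * \<epsilon> + \<epsilon>\<close> at the end
      and to stay below \<open>gap / 2\<close> at the initial time.\<close>
    define \<delta> where "\<delta> = gap / (2 * (t2 - t1))"
    have \<delta>: "\<delta> > 0" "\<delta> * (t2 - t1) = gap / 2"
      using gap lt by (auto simp: \<delta>_def divide_simps)
    define \<epsilon> where "\<epsilon> = min (\<delta> / (2 * (2 * L + 1))) (gap / 4)"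
    have \<epsilon>: "\<epsilon> > 0" "\<epsilon> < gap / 2" "(2 * L + 1) * \<epsilon> < \<delta>"
    proof -
      show "\<epsilon> > 0" "\<epsilon> < gap / 2" using \<delta> gap lip(1) by (auto simp: \<epsilon>_def)
      have "\<epsilon> \<le> \<delta> / (2 * (2 * L + 1))" by (simp add: \<epsilon>_def)
      then have "(2 * L + 1) * \<epsilon> \<le> (2 * L + 1) * (\<delta> / (2 * (2 * L + 1)))"
        using lip(1) by (intro mult_left_mono) auto
      also have "\<dots> = \<delta> / 2" using lip(1) by (simp add: field_simps)
      finally show "(2 * L + 1) * \<epsilon> < \<delta>" using \<delta> by linarith
    qed
    let ?K = "{t1..t2} \<times> {l..r}"
    have K: "compact ?K" by (intro compact_Times) auto
    have ne: "?K \<noteq> {}" using lt \<phi>(1)[of t1] by auto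
    obtain d1 where d1: "d1 > 0" "\<And>p q. p \<in> ?K \<Longrightarrow> q \<in> ?K \<Longrightarrow> dist q p < d1 \<Longrightarrow>
        dist ((\<lambda>(t, x). f t x) q) ((\<lambda>(t, x). f t x) p) < \<epsilon>"
      using compact_uniformly_continuous[OF f K] \<epsilon>(1) unfolding uniformly_continuous_on_def by metis
    obtain d2 where d2: "d2 > 0" "\<And>p q. p \<in> ?K \<Longrightarrow> q \<in> ?K \<Longrightarrow> dist q p < d2 \<Longrightarrow>
        dist ((\<lambda>(t, x). g t x) q) ((\<lambda>(t, x). g t x) p) < \<epsilon>"
      using compact_uniformly_continuous[OF g K] \<epsilon>(1) unfolding uniformly_continuous_on_def by metis
    define d where "d = min d1 d2"
    have d: "d > 0" using d1 d2 by (simp add: d_def)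
    have fd: "\<bar>f t x - f t y\<bar> < \<epsilon>" "\<bar>g t x - g t y\<bar> < \<epsilon>"
      if "t \<in> {t1..t2}" "x \<in> {l..r}" "y \<in> {l..r}" "\<bar>x - y\<bar> < d" for t x y
      using d1(2)[of "(t, y)" "(t, x)"] d2(2)[of "(t, y)" "(t, x)"] that
      by (auto simp: dist_Pair_Pair dist_real_def d_def)
    have "bounded ((\<lambda>(t, x). f t x) ` ?K)"
      by (intro compact_imp_bounded compact_continuous_image f K)
    then obtain C where C: "C > 0" "\<And>t x. t \<in> {t1..t2} \<Longrightarrow> x \<in> {l..r} \<Longrightarrow> \<bar>f t x\<bar> \<le> C"
      by (force simp: bounded_pos)
    \<comment> \<open>At distance \<open>d\<close> from the curve the penalty then exceeds
      \<open>2 * C\<close>, which bounds the oscillation of \<open>f\<close>; so the maximum point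
      lies within \<open>d\<close>.\<close>
    define N where "N = (2 * C + 1) / d\<^sup>2"
    have N: "N > 0" "2 * C < N * d\<^sup>2" using C d by (auto simp: N_def)
    have \<phi>c: "continuous_on {t1..t2} \<phi>"
      using \<phi>(2) DERIV_continuous continuous_on_eq_continuous_within by blast
    have gc: "continuous_on {t1..t2} (\<lambda>s. g s (\<phi> s))"
      by (rule continuous_on_compose_curve[OF g \<phi>c \<phi>(1)])
    define h where "h s = integral {t1..s} (\<lambda>s. g s (\<phi> s)) + \<delta> * (s - t1)" for s
    have h: "(h has_real_derivative g t (\<phi> t) + \<delta>) (at t within {t1..t2})" if "t \<in> {t1..t2}" for t
      unfolding h_def using that
      by (auto intro!: derivative_eq_intros integral_has_real_derivative gc)
    have hc: "continuous_on {t1..t2} h"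
      using h DERIV_continuous continuous_on_eq_continuous_within by blast
    define F where "F t x = f t x - h t - N * (x - \<phi> t)\<^sup>2" for t x
    have fst_c: "continuous_on ?K (\<lambda>p. k (fst p))" if "continuous_on {t1..t2} k" for k :: "real \<Rightarrow> real"
      by (rule continuous_on_compose2[OF that]) (auto intro!: continuous_intros)
    have "continuous_on ?K (\<lambda>p. (\<lambda>(t, x). f t x) p - h (fst p) - N * (snd p - \<phi> (fst p))\<^sup>2)"
      by (intro continuous_intros f fst_c hc \<phi>c)
    then obtain p where p: "p \<in> ?K"
      "\<And>q. q \<in> ?K \<Longrightarrow> (\<lambda>p. (\<lambda>(t, x). f t x) p - h (fst p) - N * (snd p - \<phi> (fst p))\<^sup>2) q
         \<le> (\<lambda>p. (\<lambda>(t, x). f t x) p - h (fst p) - N * (snd p - \<phi> (fst p))\<^sup>2) p"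
      using continuous_attains_sup[OF K ne] by blast
    obtain t x where tx: "p = (t, x)" by force
    have t: "t \<in> {t1..t2}" and x: "x \<in> {l..r}" using p(1) tx by auto
    have mx: "F s y \<le> F t x" if "s \<in> {t1..t2}" "y \<in> {l..r}" for s y
      using p(2)[of "(s, y)"] that by (simp add: F_def tx)
    have pen: "N * (x - \<phi> t)\<^sup>2 \<le> f t x - f t (\<phi> t)"
      using mx[OF t \<phi>(1)[OF t]] by (simp add: F_def)
    have "N * (x - \<phi> t)\<^sup>2 < N * d\<^sup>2"
      using pen C(2)[OF t x] C(2)[OF t \<phi>(1)[OF t]] N by linarith
    then have "(x - \<phi> t)\<^sup>2 < d\<^sup>2" using N by simp
    then have near: "\<bar>x - \<phi> t\<bar> < d" using d
      by (metis abs_of_pos power2_abs power2_less_imp_less less_imp_le)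
    \<comment> \<open>Bootstrap: within distance \<open>d\<close> the oscillation of
      \<open>f\<close> is below \<open>\<epsilon>\<close>, hence so is the penalty itself, however
      large \<open>N\<close> is.\<close>
    have pen2: "N * (x - \<phi> t)\<^sup>2 < \<epsilon>"
      using pen fd(1)[OF t x \<phi>(1)[OF t] near] by linarith
    \<comment> \<open>At \<open>t1\<close> the function \<open>h\<close> vanishes, so
      \<open>F\<close> stays below \<open>f t1 (\<phi> t1) + \<epsilon>\<close>, while the end of
      the curve attains \<open>f t1 (\<phi> t1) + gap / 2\<close>.\<close>
    have "t \<noteq> t1"
    proof
      assume "t = t1"
      have "F t2 (\<phi> t2) \<le> F t x" using lt by (intro mx \<phi>) auto
      moreover have "F t2 (\<phi> t2) = f t1 (\<phi> t1) + gap / 2"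
      proof -
        have "h t2 = integral {t1..t2} (\<lambda>s. g s (\<phi> s)) + gap / 2" using \<delta>(2) by (simp add: h_def)
        moreover have "F t2 (\<phi> t2) = f t2 (\<phi> t2) - h t2" by (simp add: F_def)
        ultimately show ?thesis using gap_def by linarith
      qed
      moreover have "F t x \<le> f t x"
        using \<open>t = t1\<close> N by (simp add: F_def h_def)
      moreover have "f t x < f t1 (\<phi> t1) + \<epsilon>"
        using fd(1)[OF t x \<phi>(1)[OF t] near] \<open>t = t1\<close> by auto
      ultimately show False using \<epsilon> by linarith
    qed
    with t have t': "t1 < t" "t \<le> t2" by auto
    obtain ft fx where D: "((\<lambda>s. f s x) has_real_derivative ft) (at t)"
        "(f t has_real_derivative fx) (at x within {l..r})" "ft + u t x * fx = g t x"
      using pde[OF t' x] by blast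
    have "((\<lambda>s. F s x) has_real_derivative ft - (g t (\<phi> t) + \<delta>) + 2 * N * (x - \<phi> t) * u t (\<phi> t))
        (at t within {t1..t2})"
      unfolding F_def
      by (rule derivative_eq_intros has_field_derivative_at_within[OF D(1)] h[OF t] \<phi>(2)[OF t] refl
          | simp)+
    from has_real_derivative_nonneg_if_max_left[OF this t'] mx x
    have Dt: "0 \<le> ft - (g t (\<phi> t) + \<delta>) + 2 * N * (x - \<phi> t) * u t (\<phi> t)" by auto
    have DFx: "(F t has_real_derivative fx - 2 * N * (x - \<phi> t)) (at x within {l..r})"
      unfolding F_def by (rule derivative_eq_intros D(2) refl | simp)+
    \<comment> \<open>At an endpoint the factor \<open>u\<close> vanishes; inside, the first-order
      condition in \<open>x\<close> makes the other factor vanish.\<close>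
    have Dx: "u t x * (fx - 2 * N * (x - \<phi> t)) = 0"
    proof (cases "x = l \<or> x = r")
      case True
      then show ?thesis using bdry t by auto
    next
      case False
      then have "l < x" "x < r" using x by auto
      then have "fx - 2 * N * (x - \<phi> t) = 0"
        using has_real_derivative_nonneg_if_max_left[OF DFx]
          has_real_derivative_nonpos_if_max_right[OF DFx] mx t by force
      then show ?thesis by simp
    qed
    \<comment> \<open>The time and space derivatives of the penalty combine into its gradient times
      an increment of \<open>u\<close>, which is at most \<open>2 * L\<close> times the
      penalty.\<close>
    have "2 * N * (x - \<phi> t) * (u t (\<phi> t) - u t x) \<le> 2 * N * (\<bar>x - \<phi> t\<bar> * \<bar>u t x - u t (\<phi> t)\<bar>)"
    proof -
      have "(x - \<phi> t) * (u t (\<phi> t) - u t x) \<le> \<bar>(x - \<phi> t) * (u t (\<phi> t) - u t x)\<bar>" by simp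
      also have "\<dots> = \<bar>x - \<phi> t\<bar> * \<bar>u t x - u t (\<phi> t)\<bar>" by (simp add: abs_mult abs_minus_commute)
      finally show ?thesis using N by (simp add: mult.assoc)
    qed
    also have "\<dots> \<le> 2 * N * (\<bar>x - \<phi> t\<bar> * (L * \<bar>x - \<phi> t\<bar>))"
      using N lip(2)[OF t x \<phi>(1)[OF t]] by (intro mult_left_mono) auto
    also have "\<dots> = 2 * L * (N * (x - \<phi> t)\<^sup>2)" by (simp add: power2_eq_square)
    also have "\<dots> \<le> 2 * L * \<epsilon>" using pen2 lip(1) by (intro mult_left_mono) auto
    finally have est: "2 * N * (x - \<phi> t) * (u t (\<phi> t) - u t x) \<le> 2 * L * \<epsilon>" .
    have "g t x < g t (\<phi> t) + \<epsilon>" using fd(2)[OF t x \<phi>(1)[OF t] near] by linarith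
    moreover have "g t x = ft + 2 * N * (x - \<phi> t) * u t x"
      using D(3) Dx by (simp add: algebra_simps)
    ultimately have "\<delta> \<le> 2 * L * \<epsilon> + \<epsilon>" using Dt est by (simp add: algebra_simps)
    then show False using \<epsilon>(3) by (simp add: algebra_simps)
  qed
  then show ?thesis by (simp add: gap_def)
qed simp

text \<open>The reverse inequality is \<open>transport_le\<close> applied to \<open>- f\<close> and
  \<open>- g\<close>.\<close>

lemma transport_eq:
  fixes f g u :: "real \<Rightarrow> real \<Rightarrow> real"
  assumes le: "t1 \<le> t2"
    and f: "continuous_on ({t1..t2} \<times> {l..r}) (\<lambda>(t, x). f t x)"
    and g: "continuous_on ({t1..t2} \<times> {l..r}) (\<lambda>(t, x). g t x)"
    and pde: "\<And>t x. t1 < t \<Longrightarrow> t \<le> t2 \<Longrightarrow> x \<in> {l..r} \<Longrightarrow> \<exists>ft fx.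
        ((\<lambda>s. f s x) has_real_derivative ft) (at t) \<and>
        (f t has_real_derivative fx) (at x within {l..r}) \<and> ft + u t x * fx = g t x"
    and bdry: "\<And>t. t \<in> {t1..t2} \<Longrightarrow> u t l = 0" "\<And>t. t \<in> {t1..t2} \<Longrightarrow> u t r = 0"
    and lip: "L \<ge> 0" "\<And>t x y. t \<in> {t1..t2} \<Longrightarrow> x \<in> {l..r} \<Longrightarrow> y \<in> {l..r} \<Longrightarrow>
        \<bar>u t x - u t y\<bar> \<le> L * \<bar>x - y\<bar>"
    and \<phi>: "\<And>t. t \<in> {t1..t2} \<Longrightarrow> \<phi> t \<in> {l..r}"
      "\<And>t. t \<in> {t1..t2} \<Longrightarrow> (\<phi> has_real_derivative u t (\<phi> t)) (at t within {t1..t2})"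
  shows "f t2 (\<phi> t2) - f t1 (\<phi> t1) = integral {t1..t2} (\<lambda>s. g s (\<phi> s))"
proof (rule antisym)
  show "f t2 (\<phi> t2) - f t1 (\<phi> t1) \<le> integral {t1..t2} (\<lambda>s. g s (\<phi> s))"
    by (rule transport_le[OF assms])
  have "- f t2 (\<phi> t2) - - f t1 (\<phi> t1) \<le> integral {t1..t2} (\<lambda>s. - g s (\<phi> s))"
  proof (rule transport_le[where u = u and L = L and l = l and r = r, OF le _ _ _ bdry lip \<phi>])
    fix t x assume "t1 < t" "t \<le> t2" "x \<in> {l..r}"
    from pde[OF this] obtain ft fx where D: "((\<lambda>s. f s x) has_real_derivative ft) (at t)"
        "(f t has_real_derivative fx) (at x within {l..r})" "ft + u t x * fx = g t x"
      by blast
    show "\<exists>ft fx. ((\<lambda>s. - f s x) has_real_derivative ft) (at t) \<and>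
        ((\<lambda>x. - f t x) has_real_derivative fx) (at x within {l..r}) \<and> ft + u t x * fx = - g t x"
      by (rule exI[of _ "- ft"], rule exI[of _ "- fx"])
        (use D in \<open>auto intro: DERIV_minus simp: algebra_simps\<close>)
  qed (use f g in \<open>auto simp: case_prod_unfold intro!: continuous_intros\<close>)
  then show "integral {t1..t2} (\<lambda>s. g s (\<phi> s)) \<le> f t2 (\<phi> t2) - f t1 (\<phi> t1)"
    by simp
qed

section \<open>Differential inequalities and ordinary differential equations\<close>

lemma gronwall_le:
  fixes z :: "real \<Rightarrow> real"
  assumes "s \<le> t" and c: "continuous_on {s..t} z"
    and d: "\<And>\<tau>. s < \<tau> \<Longrightarrow> \<tau> < t \<Longrightarrow> (z has_real_derivative z' \<tau>) (at \<tau>)"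
    and le: "\<And>\<tau>. s < \<tau> \<Longrightarrow> \<tau> < t \<Longrightarrow> z' \<tau> \<le> k * z \<tau>"
  shows "z t \<le> z s * exp (k * (t - s))"
proof -
  have "- z s * exp (- k * (s - s)) \<le> - z t * exp (- k * (t - s))"
  proof (rule DERIV_nonneg_imp_increasing_open[OF \<open>s \<le> t\<close>])
    fix \<tau> assume *: "s < \<tau>" "\<tau> < t"
    have "((\<lambda>\<tau>. - z \<tau> * exp (- k * (\<tau> - s))) has_real_derivative
       (k * z \<tau> - z' \<tau>) * exp (- k * (\<tau> - s))) (at \<tau>)"
      by (rule derivative_eq_intros d[OF *] refl | simp add: algebra_simps)+
    moreover have "(k * z \<tau> - z' \<tau>) * exp (- k * (\<tau> - s)) \<ge> 0"
      using le[OF *] by simp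
    ultimately show "\<exists>y. ((\<lambda>\<tau>. - z \<tau> * exp (- k * (\<tau> - s))) has_real_derivative y) (at \<tau>) \<and> 0 \<le> y"
      by blast
  qed (intro continuous_intros c)
  then have "z t * exp (- k * (t - s)) \<le> z s" by simp
  then have "z t * exp (- k * (t - s)) * exp (k * (t - s)) \<le> z s * exp (k * (t - s))"
    by (intro mult_right_mono) auto
  then show ?thesis by (simp add: mult.assoc flip: exp_add)
qed

lemma gronwall_ge:
  fixes z :: "real \<Rightarrow> real"
  assumes "s \<le> t" and c: "continuous_on {s..t} z"
    and d: "\<And>\<tau>. s < \<tau> \<Longrightarrow> \<tau> < t \<Longrightarrow> (z has_real_derivative z' \<tau>) (at \<tau>)"
    and ge: "\<And>\<tau>. s < \<tau> \<Longrightarrow> \<tau> < t \<Longrightarrow> k * z \<tau> \<le> z' \<tau>"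
  shows "z s * exp (k * (t - s)) \<le> z t"
  using gronwall_le[of s t "\<lambda>\<tau>. - z \<tau>" "\<lambda>\<tau>. - z' \<tau>" k] assms
  by (simp add: continuous_on_minus DERIV_minus)

text \<open>The square of \<open>z\<close> satisfies linear differential inequalities from both
  sides. The lower one keeps a positive \<open>z\<close> from reaching 0; the upper one keeps a
  vanishing initial value at 0.\<close>

lemma gronwall_sign:
  fixes z :: "real \<Rightarrow> real"
  assumes "s \<le> t" and c: "continuous_on {s..t} z"
    and d: "\<And>\<tau>. s < \<tau> \<Longrightarrow> \<tau> < t \<Longrightarrow> (z has_real_derivative z' \<tau>) (at \<tau>)"
    and le: "\<And>\<tau>. s < \<tau> \<Longrightarrow> \<tau> < t \<Longrightarrow> \<bar>z' \<tau>\<bar> \<le> k * \<bar>z \<tau>\<bar>"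
  shows "z s > 0 \<Longrightarrow> z t > 0" "z s \<ge> 0 \<Longrightarrow> z t \<ge> 0"
proof -
  have d2: "((\<lambda>\<tau>. (z \<tau>)\<^sup>2) has_real_derivative 2 * z \<tau> * z' \<tau>) (at \<tau>)" if "s < \<tau>" "\<tau> < t" for \<tau>
    using d[OF that] by (auto intro!: derivative_eq_intros)
  have abs2: "\<bar>2 * z \<tau> * z' \<tau>\<bar> \<le> 2 * k * (z \<tau>)\<^sup>2" if "s < \<tau>" "\<tau> < t" for \<tau>
  proof -
    have "\<bar>2 * z \<tau> * z' \<tau>\<bar> = 2 * (\<bar>z \<tau>\<bar> * \<bar>z' \<tau>\<bar>)" by (simp add: abs_mult)
    also have "\<dots> \<le> 2 * (\<bar>z \<tau>\<bar> * (k * \<bar>z \<tau>\<bar>))"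
      using le[OF that] by (intro mult_left_mono) auto
    also have "\<dots> = 2 * k * (z \<tau>)\<^sup>2" by (simp add: power2_eq_square)
    finally show ?thesis .
  qed
  have lower: "(z s)\<^sup>2 * exp (- (2 * k) * (\<tau> - s)) \<le> (z \<tau>)\<^sup>2" if "s \<le> \<tau>" "\<tau> \<le> t" for \<tau>
  proof (rule gronwall_ge[where z' = "\<lambda>\<tau>. 2 * z \<tau> * z' \<tau>"])
    show "continuous_on {s..\<tau>} (\<lambda>\<tau>. (z \<tau>)\<^sup>2)"
      by (intro continuous_intros continuous_on_subset[OF c]) (use that in auto)
    show "((\<lambda>a. (z a)\<^sup>2) has_real_derivative 2 * z \<tau>' * z' \<tau>') (at \<tau>')" if "s < \<tau>'" "\<tau>' < \<tau>" for \<tau>'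
      using d2[of \<tau>'] that \<open>\<tau> \<le> t\<close> by simp
    show "- (2 * k) * (z \<tau>')\<^sup>2 \<le> 2 * z \<tau>' * z' \<tau>'" if "s < \<tau>'" "\<tau>' < \<tau>" for \<tau>'
      using abs2[of \<tau>'] that \<open>\<tau> \<le> t\<close> by simp
  qed (use that in auto)
  show pos: "z t > 0" if "z s > 0"
  proof (rule ccontr)
    assume "\<not> z t > 0"
    then obtain \<tau> where \<tau>: "s \<le> \<tau>" "\<tau> \<le> t" "z \<tau> = 0"
      using IVT2'[of z t 0 s] c \<open>s \<le> t\<close> \<open>z s > 0\<close> by auto
    from lower[OF this(1,2)] this(3) have "(z s)\<^sup>2 * exp (- (2 * k) * (\<tau> - s)) \<le> 0" by simp
    moreover have "(z s)\<^sup>2 * exp (- (2 * k) * (\<tau> - s)) > 0" using \<open>z s > 0\<close> by simp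
    ultimately show False by simp
  qed
  show "z t \<ge> 0" if "z s \<ge> 0"
  proof (cases "z s = 0")
    case True
    have "(z t)\<^sup>2 \<le> (z s)\<^sup>2 * exp (2 * k * (t - s))"
      by (rule gronwall_le[where z' = "\<lambda>\<tau>. 2 * z \<tau> * z' \<tau>"])
        (use abs2 d2 \<open>s \<le> t\<close> in \<open>force intro!: continuous_intros c\<close>)+
    then show ?thesis using True by simp
  qed (use pos that in auto)
qed

section \<open>Existence of integral curves on a half-line\<close>

lemma continuous_on_lipschitz_curve:
  fixes v :: "real \<Rightarrow> real \<Rightarrow> real"
  assumes v: "\<And>x. continuous_on S (\<lambda>t. v t x)"
    and lip: "\<And>t x y. t \<in> S \<Longrightarrow> \<bar>v t x - v t y\<bar> \<le> L * \<bar>x - y\<bar>"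
    and \<xi>: "continuous_on S \<xi>"
  shows "continuous_on S (\<lambda>t. v t (\<xi> t))"
  unfolding continuous_on_def
proof
  fix s assume s: "s \<in> S"
  \<comment> \<open>Freezing the point at \<open>\<xi> s\<close> splits the increment into a part
    controlled by the Lipschitz bound and a part continuous in time.\<close>
  have "((\<lambda>t. v t (\<xi> t) - v t (\<xi> s)) \<longlongrightarrow> 0) (at s within S)"
  proof (rule Lim_null_comparison)
    show "\<forall>\<^sub>F t in at s within S. norm (v t (\<xi> t) - v t (\<xi> s)) \<le> L * \<bar>\<xi> t - \<xi> s\<bar>"
      using lip by (auto simp: eventually_at intro!: exI[of _ 1])
    have "((\<lambda>t. L * \<bar>\<xi> t - \<xi> s\<bar>) \<longlongrightarrow> L * \<bar>\<xi> s - \<xi> s\<bar>) (at s within S)"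
      using \<xi> s by (intro tendsto_intros) (auto simp: continuous_on_def)
    then show "((\<lambda>t. L * \<bar>\<xi> t - \<xi> s\<bar>) \<longlongrightarrow> 0) (at s within S)" by simp
  qed
  moreover have "((\<lambda>t. v t (\<xi> s)) \<longlongrightarrow> v s (\<xi> s)) (at s within S)"
    using v[of "\<xi> s"] s by (auto simp: continuous_on_def)
  ultimately have "((\<lambda>t. (v t (\<xi> t) - v t (\<xi> s)) + v t (\<xi> s)) \<longlongrightarrow> 0 + v s (\<xi> s)) (at s within S)"
    by (rule tendsto_add)
  then show "((\<lambda>t. v t (\<xi> t)) \<longlongrightarrow> v s (\<xi> s)) (at s within S)" by simp
qed

text \<open>The fixed point of the Picard operator is sought as \<open>\<phi> t = x0 + exp (K * t) * \<psi> t\<close> with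
  bounded \<open>\<psi>\<close>: with \<open>K = 2 * L + 1\<close> the operator contracts on the whole half-line.\<close>

lemma global_ode_solution:
  fixes v :: "real \<Rightarrow> real \<Rightarrow> real"
  assumes v: "\<And>x. continuous_on {0..} (\<lambda>t. v t x)"
    and lip: "\<And>t x y. t \<ge> 0 \<Longrightarrow> \<bar>v t x - v t y\<bar> \<le> L * \<bar>x - y\<bar>"
    and bd: "\<And>t x. t \<ge> 0 \<Longrightarrow> \<bar>v t x\<bar> \<le> M" and L: "L \<ge> 0"
  obtains \<phi> where "\<phi> 0 = x0"
    "\<And>t. t \<ge> 0 \<Longrightarrow> (\<phi> has_real_derivative v t (\<phi> t)) (at t within {0..})"
proof -
  define K where "K = 2 * L + 1"
  have K: "K > 0" "L / K \<le> 1 / 2" using L by (auto simp: K_def field_simps)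
  define G where "G \<psi> s = v s (x0 + exp (K * s) * apply_bcontfun \<psi> s)"
    for \<psi> :: "real \<Rightarrow>\<^sub>C real" and s
  have Gc: "continuous_on {0..} (G \<psi>)" for \<psi>
    unfolding G_def
    by (rule continuous_on_lipschitz_curve[OF v, where L = L]) (use lip in \<open>auto intro!: continuous_intros\<close>)
  have Gc': "continuous_on {0..b} (G \<psi>)" for \<psi> b
    by (rule continuous_on_subset[OF Gc]) auto
  have Gi: "G \<psi> integrable_on {0..b}" for \<psi> b
    by (rule integrable_continuous_real[OF Gc'])
  have M: "M \<ge> 0" using bd[of 0 0] by simp
  \<comment> \<open>\<open>max 0 t\<close> extends the operator to negative times, since bounded
    continuous functions here live on the whole line.\<close>
  define I where "I \<psi> t = integral {0..max 0 t} (G \<psi>)" for \<psi> t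
  define P where "P \<psi> t = exp (- K * max 0 t) * I \<psi> t" for \<psi> t
  have Id: "((\<lambda>t. integral {0..t} (G \<psi>)) has_real_derivative G \<psi> t) (at t within {0..})"
    if "t \<ge> 0" for \<psi> t
  proof -
    have "((\<lambda>t. integral {0..t} (G \<psi>)) has_real_derivative G \<psi> t) (at t within {0..t+1})"
      by (rule integral_has_real_derivative[OF Gc']) (use that in auto)
    moreover have "at t within {0..t+1} = at t within {0..}"
      by (rule at_within_nhd[of _ "{..<t+1}"]) (use that in auto)
    ultimately show ?thesis by simp
  qed
  have Ic: "continuous_on UNIV (I \<psi>)" for \<psi>
  proof -
    have "continuous_on {0..} (\<lambda>t. integral {0..t} (G \<psi>))"
      by (metis Id DERIV_continuous atLeast_iff continuous_on_eq_continuous_within)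
    then show ?thesis unfolding I_def
      by (rule continuous_on_compose2) (auto intro!: continuous_intros)
  qed
  \<comment> \<open>The weight \<open>exp (- K * t)\<close> absorbs the linear growth
    \<open>M * t\<close> of \<open>I\<close>, so \<open>P\<close> yields bounded functions.\<close>
  have tK: "t * exp (- K * t) \<le> 1 / K" if "t \<ge> 0" for t
  proof -
    have "1 + K * t \<le> exp (K * t)" by (rule exp_ge_add_one_self)
    then have "K * t \<le> exp (K * t)" by linarith
    then have "K * t * exp (- (K * t)) \<le> exp (K * t) * exp (- (K * t))"
      by (intro mult_right_mono) auto
    also have "\<dots> = 1" by (simp flip: exp_add)
    finally show ?thesis using K by (simp add: field_simps)
  qed
  have Pb: "P \<psi> \<in> bcontfun" for \<psi>
  proof (rule bcontfun_normI)
    show "continuous_on UNIV (P \<psi>)"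
      unfolding P_def by (intro continuous_intros Ic)
    fix t
    have "norm (I \<psi> t) \<le> M * (max 0 t - 0)"
      unfolding I_def by (rule integral_bound[OF _ Gc']) (use bd in \<open>auto simp: G_def\<close>)
    then have "norm (P \<psi> t) \<le> exp (- K * max 0 t) * (M * max 0 t)"
      by (simp add: P_def abs_mult)
    also have "\<dots> = M * (max 0 t * exp (- K * max 0 t))" by simp
    also have "\<dots> \<le> M * (1 / K)" using tK[of "max 0 t"] M by (intro mult_left_mono) auto
    finally show "norm (P \<psi> t) \<le> M * (1 / K)" .
  qed
  define T where "T \<psi> = Bcontfun (P \<psi>)" for \<psi>
  have T: "apply_bcontfun (T \<psi>) t = P \<psi> t" for \<psi> t
    unfolding T_def by (simp add: Bcontfun_inverse[OF Pb])
  have contr: "dist (T \<psi>1) (T \<psi>2) \<le> 1 / 2 * dist \<psi>1 \<psi>2" for \<psi>1 \<psi>2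
  proof -
    let ?D = "dist \<psi>1 \<psi>2"
    have "dist (apply_bcontfun (T \<psi>1) t) (apply_bcontfun (T \<psi>2) t) \<le> ?D / 2" for t
    proof -
      define s where "s = max 0 t"
      have s: "s \<ge> 0" by (simp add: s_def)
      \<comment> \<open>Integrating the weighted Lipschitz bound reproduces the weight with the
        factor \<open>L / K \<le> 1 / 2\<close>, which is the contraction constant.\<close>
      have D: "((\<lambda>\<tau>. L * ?D / K * exp (K * \<tau>)) has_real_derivative L * exp (K * \<tau>) * ?D) (at \<tau> within {0..s})" for \<tau>
        using K by (auto intro!: derivative_eq_intros)
      have ei: "((\<lambda>\<tau>. L * exp (K * \<tau>) * ?D) has_integral
          L * ?D / K * exp (K * s) - L * ?D / K * exp (K * 0)) {0..s}"
        using D by (intro fundamental_theorem_of_calculus s)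
          (auto simp flip: has_real_derivative_iff_has_vector_derivative)
      have "\<bar>I \<psi>1 t - I \<psi>2 t\<bar> = norm (integral {0..s} (\<lambda>\<tau>. G \<psi>1 \<tau> - G \<psi>2 \<tau>))"
        unfolding I_def s_def[symmetric] by (simp add: integral_diff[OF Gi Gi])
      also have "\<dots> \<le> integral {0..s} (\<lambda>\<tau>. L * exp (K * \<tau>) * ?D)"
      proof (rule integral_norm_bound_integral)
        fix \<tau> assume "\<tau> \<in> {0..s}"
        then have "norm (G \<psi>1 \<tau> - G \<psi>2 \<tau>) \<le> L * \<bar>exp (K * \<tau>) * apply_bcontfun \<psi>1 \<tau> - exp (K * \<tau>) * apply_bcontfun \<psi>2 \<tau>\<bar>"
          using lip[of \<tau> "x0 + exp (K * \<tau>) * apply_bcontfun \<psi>1 \<tau>" "x0 + exp (K * \<tau>) * apply_bcontfun \<psi>2 \<tau>"]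
          by (simp add: G_def)
        also have "\<dots> = L * (exp (K * \<tau>) * dist (apply_bcontfun \<psi>1 \<tau>) (apply_bcontfun \<psi>2 \<tau>))"
          by (simp add: dist_real_def abs_mult flip: right_diff_distrib)
        also have "\<dots> \<le> L * (exp (K * \<tau>) * ?D)"
          using L by (intro mult_left_mono dist_bounded) auto
        finally show "norm (G \<psi>1 \<tau> - G \<psi>2 \<tau>) \<le> L * exp (K * \<tau>) * ?D" by simp
      qed (use ei Gi in \<open>auto intro: integrable_diff\<close>)
      also have "\<dots> = L * ?D / K * exp (K * s) - L * ?D / K"
        using integral_unique[OF ei] by simp
      also have "\<dots> \<le> L * ?D / K * exp (K * s)" using L K by simp
      finally have "exp (- K * s) * \<bar>I \<psi>1 t - I \<psi>2 t\<bar> \<le> exp (- K * s) * (L * ?D / K * exp (K * s))"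
        by (intro mult_left_mono) auto
      also have "\<dots> = L / K * ?D" by (simp add: exp_minus)
      also have "\<dots> \<le> 1 / 2 * ?D" using K by (intro mult_right_mono) auto
      finally show ?thesis
        by (simp add: T P_def dist_real_def abs_mult s_def flip: right_diff_distrib)
    qed
    then have "dist (T \<psi>1) (T \<psi>2) \<le> ?D / 2" by (rule dist_bound)
    then show ?thesis by simp
  qed
  obtain \<psi> where \<psi>: "T \<psi> = \<psi>"
    using banach_fix_type[of "1 / 2" T] contr by auto
  define \<phi> where "\<phi> t = x0 + integral {0..t} (G \<psi>)" for t
  have \<phi>_eq: "x0 + exp (K * t) * apply_bcontfun \<psi> t = \<phi> t" if "t \<ge> 0" for t
  proof -
    have "apply_bcontfun \<psi> t = exp (- K * t) * integral {0..t} (G \<psi>)"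
      using T[of \<psi> t] that by (simp add: \<psi> P_def I_def)
    then show ?thesis by (simp add: \<phi>_def flip: exp_add mult.assoc)
  qed
  show thesis
  proof
    show "\<phi> 0 = x0" by (simp add: \<phi>_def)
    fix t :: real assume t: "t \<ge> 0"
    have "(\<phi> has_real_derivative G \<psi> t) (at t within {0..})"
      unfolding \<phi>_def using Id[OF t, of \<psi>] by (auto intro!: derivative_eq_intros)
    then show "(\<phi> has_real_derivative v t (\<phi> t)) (at t within {0..})"
      using \<phi>_eq[OF t] by (simp add: G_def)
  qed
qed

text \<open>Clamping the space variable to \<open>{l..r}\<close> makes the field globally Lipschitz
  and bounded. Both endpoints are equilibria, so \<open>gronwall_sign\<close> applied to the
  distances from them keeps the solution inside, where the clamp is the identity.\<close>

lemma confined_ode_solution: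
  fixes v :: "real \<Rightarrow> real \<Rightarrow> real"
  assumes v: "\<And>x. x \<in> {l..r} \<Longrightarrow> continuous_on {0..} (\<lambda>t. v t x)"
    and lip: "\<And>t x y. t \<ge> 0 \<Longrightarrow> x \<in> {l..r} \<Longrightarrow> y \<in> {l..r} \<Longrightarrow> \<bar>v t x - v t y\<bar> \<le> L * \<bar>x - y\<bar>"
    and bdry: "\<And>t. t \<ge> 0 \<Longrightarrow> v t l = 0" "\<And>t. t \<ge> 0 \<Longrightarrow> v t r = 0"
    and L: "L \<ge> 0" and x0: "x0 \<in> {l..r}"
  obtains \<phi> where "\<phi> 0 = x0" "\<And>t. t \<ge> 0 \<Longrightarrow> \<phi> t \<in> {l..r}"
    "\<And>t. t \<ge> 0 \<Longrightarrow> (\<phi> has_real_derivative v t (\<phi> t)) (at t within {0..})"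
proof -
  have lr: "l \<le> r" using x0 by simp
  define cl where "cl x = max l (min r x)" for x
  have cl: "cl x \<in> {l..r}" for x using lr by (auto simp: cl_def)
  have cl_lip: "\<bar>cl x - cl y\<bar> \<le> \<bar>x - y\<bar>" for x y by (auto simp: cl_def)
  have cl_id: "cl x = x" if "x \<in> {l..r}" for x using that by (auto simp: cl_def)
  have vlip: "\<bar>v t (cl x) - v t (cl y)\<bar> \<le> L * \<bar>x - y\<bar>" if "t \<ge> 0" for t x y
    using lip[OF that cl cl, of x y] mult_left_mono[OF cl_lip[of x y] L] by linarith
  have vbd: "\<bar>v t (cl x)\<bar> \<le> L * (r - l)" if "t \<ge> 0" for t x
  proof -
    have "\<bar>v t (cl x)\<bar> \<le> L * \<bar>cl x - l\<bar>" using lip[OF that cl, of l x] bdry(1)[OF that] lr by simp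
    also have "\<dots> \<le> L * (r - l)" using cl[of x] L by (intro mult_left_mono) auto
    finally show ?thesis .
  qed
  obtain \<phi> where \<phi>: "\<phi> 0 = x0"
    "\<And>t. t \<ge> 0 \<Longrightarrow> (\<phi> has_real_derivative v t (cl (\<phi> t))) (at t within {0..})"
    using global_ode_solution[of "\<lambda>t x. v t (cl x)" L "L * (r - l)" x0] v[OF cl] vlip vbd L by blast
  have \<phi>': "(\<phi> has_real_derivative v t (cl (\<phi> t))) (at t)" if "t > 0" for t
    using \<phi>(2)[of t] that at_within_interior[of t "{0..}"] by simp
  have \<phi>c: "continuous_on {0..t} \<phi>" for t
    by (rule continuous_on_subset[of "{0..}"])
      (auto simp: continuous_on_eq_continuous_within intro!: DERIV_continuous \<phi>(2))
  have inside: "\<phi> t \<in> {l..r}" if t: "t \<ge> 0" for t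
  proof -
    have "r - \<phi> t \<ge> 0"
    proof (rule gronwall_sign(2)[OF t, of "\<lambda>t. r - \<phi> t" "\<lambda>t. - v t (cl (\<phi> t))" L])
      show "\<bar>- v \<tau> (cl (\<phi> \<tau>))\<bar> \<le> L * \<bar>r - \<phi> \<tau>\<bar>" if "0 < \<tau>" "\<tau> < t" for \<tau>
        using vlip[of \<tau> "\<phi> \<tau>" r] bdry(2)[of \<tau>] cl_id[of r] lr that
        by (simp add: abs_minus_commute)
    qed (use x0 \<phi>(1) in \<open>auto intro!: continuous_intros \<phi>c derivative_eq_intros \<phi>'\<close>)
    moreover have "\<phi> t - l \<ge> 0"
    proof (rule gronwall_sign(2)[OF t, of "\<lambda>t. \<phi> t - l" "\<lambda>t. v t (cl (\<phi> t))" L])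
      show "\<bar>v \<tau> (cl (\<phi> \<tau>))\<bar> \<le> L * \<bar>\<phi> \<tau> - l\<bar>" if "0 < \<tau>" "\<tau> < t" for \<tau>
        using vlip[of \<tau> "\<phi> \<tau>" l] bdry(1)[of \<tau>] cl_id[of l] lr that by simp
    qed (use x0 \<phi>(1) in \<open>auto intro!: continuous_intros \<phi>c derivative_eq_intros \<phi>'\<close>)
    ultimately show ?thesis by simp
  qed
  show thesis
  proof (rule that[of \<phi>])
    show "(\<phi> has_real_derivative v t (\<phi> t)) (at t within {0..})" if "t \<ge> 0" for t
      using \<phi>(2)[OF that] cl_id[OF inside[OF that]] by simp
  qed (fact \<phi>(1) inside)+
qed

section \<open>Bounded solutions\<close>

lemma cos_ge_quadratic: "1 - x\<^sup>2 / 2 \<le> cos x" for x :: real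
proof -
  have "(sin (x / 2))\<^sup>2 \<le> (x / 2)\<^sup>2"
    using abs_sin_x_le_abs_x[of "x / 2"] by (metis abs_le_square_iff)
  moreover have "cos x = 1 - 2 * (sin (x / 2))\<^sup>2"
    using cos_double_sin[of "x / 2"] by simp
  ultimately show ?thesis by (simp add: power_divide)
qed

text \<open>The bound \<open>B\<close>, which \<open>global_solution_bounded\<close> derives from
  convergence, is a Lipschitz constant of \<open>u\<close> in space, uniform in time.\<close>

locale bounded_solution =
  fixes a :: "real \<Rightarrow> real \<Rightarrow> real" and a0 :: "real \<Rightarrow> real" and B :: real
  assumes sol: "global_solution a a0"
    and bd: "\<And>t x. t \<ge> 0 \<Longrightarrow> x \<in> {-pi..pi} \<Longrightarrow> \<bar>a t x\<bar> \<le> B"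
begin

definition u :: "real \<Rightarrow> real \<Rightarrow> real" where
  "u t x = integral {-pi..x} (a t)"

definition c :: "real \<Rightarrow> real" where
  "c t = (1 / pi) * integral {-pi..pi} (\<lambda>y. (a t y)\<^sup>2)"

text \<open>The finite horizon \<open>T\<close> admits curves obtained by reversing time from a
  prescribed end point.\<close>

definition characteristic :: "real \<Rightarrow> (real \<Rightarrow> real) \<Rightarrow> bool" where
  "characteristic T \<phi> \<longleftrightarrow> (\<forall>t\<in>{0..T}. \<phi> t \<in> {-pi..pi} \<and>
     (\<phi> has_real_derivative u t (\<phi> t)) (at t within {0..T}))"

lemma B_nonneg: "B \<ge> 0"
  using bd[of 0 0] by simp

lemma a_cont: "continuous_on ({0..} \<times> {-pi..pi}) (\<lambda>(t, x). a t x)"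
  and a_init: "x \<in> {-pi..pi} \<Longrightarrow> a 0 x = a0 x"
  and a_mean: "t \<ge> 0 \<Longrightarrow> integral {-pi..pi} (a t) = 0"
  using sol by (auto simp: global_solution_def)

lemma a_pde: "t > 0 \<Longrightarrow> x \<in> {-pi..pi} \<Longrightarrow> \<exists>dt dx.
    ((\<lambda>s. a s x) has_real_derivative dt) (at t) \<and>
    (a t has_real_derivative dx) (at x within {-pi..pi}) \<and>
    dt + u t x * dx = (a t x)\<^sup>2 - c t"
  using sol unfolding global_solution_def u_def c_def by (force simp: algebra_simps)

lemma a_cont_x:
  assumes "t \<ge> 0"
  shows "continuous_on {-pi..pi} (a t)"
proof -
  have "continuous_on {-pi..pi} (\<lambda>x. (\<lambda>(t, x). a t x) (t, x))"
    by (rule continuous_on_compose2[OF a_cont]) (use assms in \<open>auto intro!: continuous_intros\<close>)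
  then show ?thesis by simp
qed

lemma a_integrable: "t \<ge> 0 \<Longrightarrow> -pi \<le> x \<Longrightarrow> y \<le> pi \<Longrightarrow> a t integrable_on {x..y}"
  by (rule integrable_continuous_real[OF continuous_on_subset[OF a_cont_x]]) auto

text \<open>The zero mean makes \<open>pi\<close> an equilibrium of the flow just like
  \<open>-pi\<close>, so characteristics cannot leave the interval.\<close>

lemma u_left: "u t (-pi) = 0"
  and u_right: "t \<ge> 0 \<Longrightarrow> u t pi = 0"
  using a_mean by (simp_all add: u_def)

lemma u_diff: "t \<ge> 0 \<Longrightarrow> -pi \<le> x \<Longrightarrow> x \<le> y \<Longrightarrow> y \<le> pi \<Longrightarrow> u t y - u t x = integral {x..y} (a t)"
  using Henstock_Kurzweil_Integration.integral_combine[where a = "-pi" and c = x and b = y and f = "a t"] a_integrable[of t "-pi" y] by (simp add: u_def)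

lemma u_diff_le:
  assumes "t \<ge> 0" "-pi \<le> x" "x \<le> y" "y \<le> pi" "\<And>s. s \<in> {x..y} \<Longrightarrow> a t s \<le> k"
  shows "u t y - u t x \<le> k * (y - x)"
proof -
  have "integral {x..y} (a t) \<le> integral {x..y} (\<lambda>_. k)"
    by (rule integral_le) (use assms a_integrable in auto)
  then show ?thesis using assms by (simp add: u_diff mult.commute)
qed

lemma u_diff_ge:
  assumes "t \<ge> 0" "-pi \<le> x" "x \<le> y" "y \<le> pi" "\<And>s. s \<in> {x..y} \<Longrightarrow> k \<le> a t s"
  shows "k * (y - x) \<le> u t y - u t x"
proof -
  have "integral {x..y} (\<lambda>_. k) \<le> integral {x..y} (a t)"
    by (rule integral_le) (use assms a_integrable in auto)
  then show ?thesis using assms by (simp add: u_diff mult.commute)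
qed

lemma u_lipschitz:
  assumes "t \<ge> 0" "x \<in> {-pi..pi}" "y \<in> {-pi..pi}"
  shows "\<bar>u t x - u t y\<bar> \<le> B * \<bar>x - y\<bar>"
proof -
  have *: "\<bar>u t y - u t x\<bar> \<le> B * (y - x)" if "x \<le> y" "-pi \<le> x" "y \<le> pi" for x y
  proof -
    have ab: "-B \<le> a t s \<and> a t s \<le> B" if "s \<in> {x..y}" for s
      using bd[of t s] that \<open>-pi \<le> x\<close> \<open>y \<le> pi\<close> assms(1) by auto
    show ?thesis
      using u_diff_le[of t x y B] u_diff_ge[of t x y "-B"] ab that assms(1) by auto
  qed
  show ?thesis using *[of x y] *[of y x] assms by (cases "x \<le> y") (auto simp: abs_minus_commute)
qed

lemma u_cont_t:
  assumes "x \<in> {-pi..pi}"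
  shows "continuous_on {0..} (\<lambda>t. u t x)"
proof -
  have "continuous_on {0..} (\<lambda>t. integral (cbox (-pi) x) (a t))"
    by (rule integral_continuous_on_param, rule continuous_on_subset[OF a_cont]) (use assms in auto)
  then show ?thesis by (simp add: u_def)
qed

lemma c_cont: "continuous_on {0..} c"
proof -
  have "continuous_on {0..} (\<lambda>t. integral (cbox (-pi) pi) (\<lambda>x. (a t x)\<^sup>2))"
    by (rule integral_continuous_on_param)
      (use a_cont in \<open>auto simp: case_prod_unfold intro!: continuous_intros\<close>)
  then have "continuous_on {0..} (\<lambda>t. (1 / pi) * integral {-pi..pi} (\<lambda>x. (a t x)\<^sup>2))"
    by (intro continuous_intros) simp
  then show ?thesis by (simp add: c_def[abs_def])
qed

section \<open>Construction of characteristics\<close>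

lemma characteristic_forward:
  assumes "x \<in> {-pi..pi}"
  obtains \<phi> where "\<phi> 0 = x" "\<And>T. characteristic T \<phi>"
proof -
  obtain \<phi> where \<phi>: "\<phi> 0 = x" "\<And>t. t \<ge> 0 \<Longrightarrow> \<phi> t \<in> {-pi..pi}"
    "\<And>t. t \<ge> 0 \<Longrightarrow> (\<phi> has_real_derivative u t (\<phi> t)) (at t within {0..})"
    using confined_ode_solution[OF u_cont_t u_lipschitz u_left u_right B_nonneg assms] by blast
  have "characteristic T \<phi>" for T
    unfolding characteristic_def
  proof (intro ballI conjI)
    fix t assume t: "t \<in> {0..T}"
    show "\<phi> t \<in> {-pi..pi}" using \<phi>(2) t by simp
    show "(\<phi> has_real_derivative u t (\<phi> t)) (at t within {0..T})"
      by (rule DERIV_subset[OF \<phi>(3)]) (use t in auto)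
  qed
  with \<phi>(1) show thesis by (rule that)
qed

text \<open>Serves to trace an arbitrary point at time \<open>T\<close> back to the initial datum,
  whose extrema are known.\<close>

lemma characteristic_backward:
  assumes T: "T \<ge> 0" and y: "y \<in> {-pi..pi}"
  obtains \<phi> where "\<phi> T = y" "characteristic T \<phi>"
proof -
  \<comment> \<open>Time reversal; \<open>max 0\<close> freezes the field at time 0 once the
    reversed time exceeds \<open>T\<close>, so that it is defined on the half-line.\<close>
  let ?v = "\<lambda>t x. - u (max 0 (T - t)) x"
  have vc: "continuous_on {0..} (\<lambda>t. ?v t x)" if "x \<in> {-pi..pi}" for x
    by (intro continuous_on_minus continuous_on_compose2[OF u_cont_t[OF that]])
      (auto intro!: continuous_intros)
  have vl: "\<bar>?v t x - ?v t y\<bar> \<le> B * \<bar>x - y\<bar>"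
    if "t \<ge> 0" "x \<in> {-pi..pi}" "y \<in> {-pi..pi}" for t x y
    using u_lipschitz[of "max 0 (T - t)" x y] that by auto
  obtain \<psi> where \<psi>: "\<psi> 0 = y" "\<And>t. t \<ge> 0 \<Longrightarrow> \<psi> t \<in> {-pi..pi}"
    "\<And>t. t \<ge> 0 \<Longrightarrow> (\<psi> has_real_derivative ?v t (\<psi> t)) (at t within {0..})"
    using confined_ode_solution[OF vc vl _ _ B_nonneg y] u_left u_right by auto
  show thesis
  proof (rule that[of "\<lambda>t. \<psi> (T - t)"])
    show "characteristic T (\<lambda>t. \<psi> (T - t))"
      unfolding characteristic_def
    proof (intro ballI conjI)
      fix t assume t: "t \<in> {0..T}"
      show "\<psi> (T - t) \<in> {-pi..pi}" using \<psi>(2)[of "T - t"] t by simp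
      have "(\<psi> has_real_derivative ?v (T - t) (\<psi> (T - t))) (at (T - t) within (\<lambda>t. T - t) ` {0..T})"
        by (rule DERIV_subset[OF \<psi>(3)]) (use t in auto)
      then have "((\<psi> \<circ> (\<lambda>t. T - t)) has_real_derivative ?v (T - t) (\<psi> (T - t)) * -1) (at t within {0..T})"
        by (rule DERIV_image_chain) (auto intro!: derivative_eq_intros)
      then show "((\<lambda>t. \<psi> (T - t)) has_real_derivative u t (\<psi> (T - t))) (at t within {0..T})"
        using t by (simp add: o_def)
    qed
  qed (simp add: \<psi>(1))
qed

lemma characteristic_mem: "characteristic T \<phi> \<Longrightarrow> 0 \<le> t \<Longrightarrow> t \<le> T \<Longrightarrow> \<phi> t \<in> {-pi..pi}"
  by (simp add: characteristic_def)

lemma characteristic_mono: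
  "characteristic T \<phi> \<Longrightarrow> S \<le> T \<Longrightarrow> characteristic S \<phi>"
  unfolding characteristic_def by (fastforce elim: DERIV_subset)

lemma characteristic_left: "characteristic T (\<lambda>_. -pi)"
  by (auto simp: characteristic_def u_left)

lemma characteristic_cont:
  "characteristic T \<phi> \<Longrightarrow> continuous_on {0..T} \<phi>"
  unfolding characteristic_def continuous_on_eq_continuous_within by (blast intro: DERIV_continuous)

lemma characteristic_deriv:
  "characteristic T \<phi> \<Longrightarrow> 0 < t \<Longrightarrow> t < T \<Longrightarrow> (\<phi> has_real_derivative u t (\<phi> t)) (at t)"
  unfolding characteristic_def by (metis at_within_Icc_at atLeastAtMost_iff less_imp_le)

section \<open>Order and spacing along characteristics\<close>

lemma along_cont:
  assumes "characteristic T \<phi>"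
  shows "continuous_on {0..T} (\<lambda>t. a t (\<phi> t))"
  by (rule continuous_on_compose_curve[of _ "{-pi..pi}"])
    (use assms characteristic_cont in \<open>auto simp: characteristic_def intro: continuous_on_subset[OF a_cont]\<close>)

text \<open>\<open>transport_eq\<close> on every \<open>{0..s}\<close> gives the equation in
  integrated form; the integrand is continuous, so the integral can be differentiated.\<close>

lemma along_deriv:
  assumes ch: "characteristic T \<phi>" and t: "0 < t" "t < T"
  shows "((\<lambda>t. a t (\<phi> t)) has_real_derivative (a t (\<phi> t))\<^sup>2 - c t) (at t)"
proof -
  let ?g = "\<lambda>t. (a t (\<phi> t))\<^sup>2 - c t"
  have g: "continuous_on {0..T} ?g"
    by (intro continuous_intros along_cont[OF ch] continuous_on_subset[OF c_cont]) auto
  have eq: "a s (\<phi> s) = a 0 (\<phi> 0) + integral {0..s} ?g" if s: "s \<in> {0..T}" for s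
  proof -
    have sub: "{0..s} \<times> {-pi..pi} \<subseteq> {0..} \<times> {-pi..pi}" by auto
    have chs: "characteristic s \<phi>" using characteristic_mono[OF ch] s by simp
    have "a s (\<phi> s) - a 0 (\<phi> 0) = integral {0..s} ?g"
    proof (rule transport_eq[where u = u and L = B and l = "-pi" and r = pi
          and g = "\<lambda>t x. (a t x)\<^sup>2 - c t"])
      show "continuous_on ({0..s} \<times> {-pi..pi}) (\<lambda>(t, x). a t x)"
        by (rule continuous_on_subset[OF a_cont sub])
      then have "continuous_on ({0..s} \<times> {-pi..pi}) (\<lambda>p. ((\<lambda>(t, x). a t x) p)\<^sup>2 - c (fst p))"
        by (intro continuous_intros continuous_on_compose2[OF c_cont]) auto
      then show "continuous_on ({0..s} \<times> {-pi..pi}) (\<lambda>(t, x). (a t x)\<^sup>2 - c t)"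
        by (simp add: case_prod_unfold)
      show "\<phi> t \<in> {-pi..pi}" if "t \<in> {0..s}" for t
        using characteristic_mem[OF chs] that by simp
      show "(\<phi> has_real_derivative u t (\<phi> t)) (at t within {0..s})" if "t \<in> {0..s}" for t
        using chs that by (simp add: characteristic_def)
    qed (use s a_pde B_nonneg u_lipschitz u_left u_right in simp_all)
    then show ?thesis by simp
  qed
  have "((\<lambda>s. a 0 (\<phi> 0) + integral {0..s} ?g) has_real_derivative ?g t) (at t within {0..T})"
    using integral_has_real_derivative[OF g, of t] t by (auto intro!: derivative_eq_intros)
  then have "((\<lambda>t. a t (\<phi> t)) has_real_derivative ?g t) (at t within {0..T})"
    by (rule has_field_derivative_transform_within[OF _ zero_less_one _ eq[symmetric]])
      (use t in auto)
  then show ?thesis using t at_within_Icc_at[of 0 t T] by simp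
qed

text \<open>The nonlocal term \<open>c\<close> is common to both curves and cancels, and the
  difference of squares factors.\<close>

lemma along_diff_deriv:
  assumes "characteristic T \<phi>" "characteristic T \<psi>" "0 < t" "t < T"
  shows "((\<lambda>t. a t (\<psi> t) - a t (\<phi> t)) has_real_derivative
    (a t (\<psi> t) + a t (\<phi> t)) * (a t (\<psi> t) - a t (\<phi> t))) (at t)"
  by (rule derivative_eq_intros along_deriv[OF assms(1,3,4)] along_deriv[OF assms(2,3,4)] refl)+
    (simp add: algebra_simps power2_eq_square)

lemma along_diff_growth:
  assumes "characteristic T \<phi>" "characteristic T \<psi>" "0 < t" "t < T"
  shows "\<bar>(a t (\<psi> t) + a t (\<phi> t)) * (a t (\<psi> t) - a t (\<phi> t))\<bar>
    \<le> 2 * B * \<bar>a t (\<psi> t) - a t (\<phi> t)\<bar>"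
proof -
  have "\<bar>a t (\<psi> t) + a t (\<phi> t)\<bar> \<le> 2 * B"
    using bd[of t "\<phi> t"] bd[of t "\<psi> t"] characteristic_mem[of T \<phi> t] characteristic_mem[of T \<psi> t]
      assms by simp
  then show ?thesis by (simp add: abs_mult mult_right_mono)
qed

text \<open>The difference solves a linear equation whose coefficient is at most
  \<open>2 * B\<close> in absolute value, so \<open>gronwall_sign\<close> applies.\<close>

lemma along_order:
  assumes \<phi>: "characteristic T \<phi>" and \<psi>: "characteristic T \<psi>" and T: "T \<ge> 0"
  shows "a 0 (\<phi> 0) \<le> a 0 (\<psi> 0) \<Longrightarrow> a T (\<phi> T) \<le> a T (\<psi> T)"
    and "a 0 (\<phi> 0) < a 0 (\<psi> 0) \<Longrightarrow> a T (\<phi> T) < a T (\<psi> T)"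
  using gronwall_sign[OF T continuous_on_diff[OF along_cont[OF \<psi>] along_cont[OF \<phi>]]
      along_diff_deriv[OF \<phi> \<psi>] along_diff_growth[OF \<phi> \<psi>]]
  by auto

text \<open>Trace the competitor \<open>x\<close> back to time 0, compare the initial values there
  and carry the order forward.\<close>

lemma max_along:
  assumes p: "characteristic T p" and T: "T \<ge> 0" and x: "x \<in> {-pi..pi}"
    and max: "\<And>y. y \<in> {-pi..pi} \<Longrightarrow> a0 y \<le> a0 (p 0)"
  shows "a T x \<le> a T (p T)"
proof -
  obtain \<phi> where \<phi>: "\<phi> T = x" "characteristic T \<phi>" using characteristic_backward[OF T x] .
  have "\<phi> 0 \<in> {-pi..pi}" "p 0 \<in> {-pi..pi}" using characteristic_mem[OF \<phi>(2), of 0] characteristic_mem[OF p, of 0] T by simp_all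
  then show ?thesis
    using along_order(1)[OF \<phi>(2) p T] max[of "\<phi> 0"] \<phi>(1) by (simp add: a_init)
qed

lemma min_along:
  assumes p: "characteristic T p" and T: "T \<ge> 0" and x: "x \<in> {-pi..pi}"
    and min: "\<And>y. y \<in> {-pi..pi} \<Longrightarrow> a0 (p 0) \<le> a0 y"
  shows "a T (p T) \<le> a T x"
proof -
  obtain \<phi> where \<phi>: "\<phi> T = x" "characteristic T \<phi>" using characteristic_backward[OF T x] .
  have "\<phi> 0 \<in> {-pi..pi}" "p 0 \<in> {-pi..pi}" using characteristic_mem[OF \<phi>(2), of 0] characteristic_mem[OF p, of 0] T by simp_all
  then show ?thesis
    using along_order(1)[OF p \<phi>(2) T] min[of "\<phi> 0"] \<phi>(1) by (simp add: a_init)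
qed

text \<open>By the Lipschitz bound on \<open>u\<close>, the derivative of the distance is at most
  \<open>B\<close> times the distance in absolute value.\<close>

lemma characteristics_separate:
  assumes \<phi>: "characteristic T \<phi>" and \<psi>: "characteristic T \<psi>" and T: "T \<ge> 0"
    and less: "\<phi> 0 < \<psi> 0"
  shows "\<phi> T < \<psi> T" "\<psi> T - \<phi> T \<le> (\<psi> 0 - \<phi> 0) * exp (B * T)"
proof -
  have zc: "continuous_on {0..S} (\<lambda>t. \<psi> t - \<phi> t)" if "S \<le> T" for S
    by (intro continuous_on_diff continuous_on_subset[OF characteristic_cont[OF \<phi>]]
        continuous_on_subset[OF characteristic_cont[OF \<psi>]]) (use that in auto)
  have zd: "((\<lambda>t. \<psi> t - \<phi> t) has_real_derivative u t (\<psi> t) - u t (\<phi> t)) (at t)"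
    if "0 < t" "t < T" for t
    by (intro DERIV_diff characteristic_deriv[OF \<phi>] characteristic_deriv[OF \<psi>] that)
  have lip: "\<bar>u t (\<psi> t) - u t (\<phi> t)\<bar> \<le> B * \<bar>\<psi> t - \<phi> t\<bar>" if "0 < t" "t < T" for t
    by (rule u_lipschitz) (use that characteristic_mem[OF \<phi>] characteristic_mem[OF \<psi>] in auto)
  have pos: "\<psi> S - \<phi> S > 0" if "0 \<le> S" "S \<le> T" for S
    by (rule gronwall_sign(1)[OF that(1) zc[OF that(2)] zd lip]) (use that less in auto)
  show "\<phi> T < \<psi> T" using pos[of T] T by simp
  have "\<psi> T - \<phi> T \<le> (\<psi> 0 - \<phi> 0) * exp (B * (T - 0))"
  proof (rule gronwall_le[OF T zc[OF order_refl] zd])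
    show "u t (\<psi> t) - u t (\<phi> t) \<le> B * (\<psi> t - \<phi> t)" if "0 < t" "t < T" for t
      using lip[OF that] pos[of t] that by simp
  qed
  then show "\<psi> T - \<phi> T \<le> (\<psi> 0 - \<phi> 0) * exp (B * T)" by simp
qed

text \<open>\<open>along_order\<close> keeps the difference positive, so the lower bound
  \<open>k\<close> on its growth rate can be multiplied by it.\<close>

lemma along_diff_lower:
  assumes \<phi>: "characteristic T \<phi>" and \<psi>: "characteristic T \<psi>" and s: "0 \<le> s" "s \<le> T"
    and less: "a 0 (\<phi> 0) < a 0 (\<psi> 0)"
    and k: "\<And>t. s < t \<Longrightarrow> t < T \<Longrightarrow> k \<le> a t (\<psi> t) + a t (\<phi> t)"
  shows "(a s (\<psi> s) - a s (\<phi> s)) * exp (k * (T - s)) \<le> a T (\<psi> T) - a T (\<phi> T)"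
proof (rule gronwall_ge[OF s(2)])
  show "continuous_on {s..T} (\<lambda>t. a t (\<psi> t) - a t (\<phi> t))"
    by (intro continuous_on_diff continuous_on_subset[OF along_cont[OF \<phi>]]
        continuous_on_subset[OF along_cont[OF \<psi>]]) (use s in auto)
  fix t assume t: "s < t" "t < T"
  show "((\<lambda>t. a t (\<psi> t) - a t (\<phi> t)) has_real_derivative
    (a t (\<psi> t) + a t (\<phi> t)) * (a t (\<psi> t) - a t (\<phi> t))) (at t)"
    by (rule along_diff_deriv[OF \<phi> \<psi>]) (use t s in auto)
  have "a t (\<phi> t) < a t (\<psi> t)"
    by (rule along_order(2)[OF characteristic_mono[OF \<phi>] characteristic_mono[OF \<psi>] _ less])
      (use t s in auto)
  then show "k * (a t (\<psi> t) - a t (\<phi> t)) \<le> (a t (\<psi> t) + a t (\<phi> t)) * (a t (\<psi> t) - a t (\<phi> t))"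
    using k[OF t] by (intro mult_right_mono) auto
qed

text \<open>Two characteristics that start at distance \<open>exp (-\<xi>)\<close> separate at a rate at most
  \<open>\<mu> (1 + \<kappa>)\<close>, whereas the difference of \<open>a\<close> along them grows at a rate at least
  \<open>2 \<mu> (1 - \<kappa>)\<close>; eliminating the time at which their distance reaches \<open>r\<close> leaves this bound.\<close>

lemma escape_estimate:
  assumes p: "\<And>T. characteristic T p" "p 0 = 0"
    and \<mu>: "\<mu> > 0" and \<kappa>: "0 < \<kappa>" "\<kappa> < 1" and r: "0 < r" "2 * r \<le> pi" and T: "T \<ge> 0"
    and p_small: "\<And>t. t \<ge> T \<Longrightarrow> \<bar>p t\<bar> \<le> r"
    and a_near: "\<And>t x. t \<ge> T \<Longrightarrow> \<bar>x\<bar> \<le> 2 * r \<Longrightarrow> \<mu> * (1 - \<kappa>) \<le> a t x \<and> a t x \<le> \<mu> * (1 + \<kappa>)"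
    and \<delta>: "\<delta> > 0" and \<xi>: "\<xi> \<ge> 0"
    and gap: "\<delta> * exp (- \<beta> * \<xi>) \<le> a0 0 - a0 (exp (- \<xi>))"
  shows "(1 + \<kappa>) * (ln \<delta> - \<beta> * \<xi> - 2 * B * T - 2 * B) + 2 * (1 - \<kappa>) * (ln r + \<xi> - B * T) \<le> 0"
proof -
  define x where "x = exp (- \<xi>)"
  have x: "0 < x" "x \<le> 1" using \<xi> by (auto simp: x_def)
  have x_mem: "x \<in> {-pi..pi}" using x pi_gt3 by auto
  obtain \<phi> where \<phi>: "\<phi> 0 = x" "\<And>T. characteristic T \<phi>" using characteristic_forward[OF x_mem] by metis
  define z where "z t = \<phi> t - p t" for t
  define w where "w t = a t (p t) - a t (\<phi> t)" for t
  have z_pos: "z t > 0" if "t \<ge> 0" for t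
    using characteristics_separate(1)[OF p(1) \<phi>(2) that] p(2) \<phi>(1) x by (simp add: z_def)
  \<comment> \<open>Up to time \<open>T\<close> only the bound \<open>B\<close> is available. The
    resulting crude rates \<open>B\<close> and, below, \<open>2 * B\<close> cost factors that do not
    depend on \<open>\<xi>\<close>.\<close>
  have zT: "z T \<le> exp (- \<xi> + B * T)"
    using characteristics_separate(2)[OF p(1) \<phi>(2) T] p(2) \<phi>(1) x
    by (simp add: z_def x_def mult_exp_exp)
  have zc: "continuous_on {s..t} z" if "0 \<le> s" for s t
    unfolding z_def
    by (intro continuous_on_diff continuous_on_subset[OF characteristic_cont[OF \<phi>(2)[of t]]]
        continuous_on_subset[OF characteristic_cont[OF p(1)[of t]]]) (use that in auto)
  have zd: "(z has_real_derivative u t (\<phi> t) - u t (p t)) (at t)" if "0 < t" for t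
    unfolding z_def
    by (intro DERIV_diff characteristic_deriv[OF \<phi>(2)[of "t + 1"]]
        characteristic_deriv[OF p(1)[of "t + 1"]]) (use that in auto)
  \<comment> \<open>While the distance is below \<open>r\<close>, the whole segment between the two
    curves lies where \<open>a_near\<close> applies; \<open>u\<close> changes along it by the
    integral of \<open>a\<close>.\<close>
  have in_window: "\<bar>y\<bar> \<le> 2 * r" if "t \<ge> T" "z t < r" "y \<in> {p t..\<phi> t}" for t y
    using p_small[OF that(1)] that(2,3) by (auto simp: z_def)
  have mem: "p t \<in> {-pi..pi}" "\<phi> t \<in> {-pi..pi}" if "t \<ge> 0" for t
    using characteristic_mem[OF p(1) that order_refl] characteristic_mem[OF \<phi>(2) that order_refl] .
  have z'_le: "u t (\<phi> t) - u t (p t) \<le> \<mu> * (1 + \<kappa>) * z t"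
    and z'_ge: "\<mu> * (1 - \<kappa>) * z t \<le> u t (\<phi> t) - u t (p t)" if "t \<ge> T" "z t < r" for t
    unfolding z_def using mem[of t] z_pos[of t] T that in_window[OF that] a_near[OF that(1)]
    by (intro u_diff_le u_diff_ge; simp add: z_def)+
  have less: "a 0 (\<phi> 0) < a 0 (p 0)"
  proof -
    have "0 < \<delta> * exp (- \<beta> * \<xi>)" using \<delta> by simp
    then have "a0 x < a0 0" using gap by (simp add: x_def)
    then show ?thesis using \<phi>(1) p(2) x_mem by (simp add: a_init)
  qed
  have w0: "\<delta> * exp (- \<beta> * \<xi>) \<le> w 0"
    using gap \<phi>(1) p(2) x_mem by (simp add: w_def a_init x_def)
  have "w 0 * exp (- (2 * B) * (T - 0)) \<le> w T"
    unfolding w_def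
  proof (rule along_diff_lower[OF \<phi>(2) p(1) order_refl T less])
    show "- (2 * B) \<le> a t (p t) + a t (\<phi> t)" if "0 < t" "t < T" for t
      using bd[of t "p t"] bd[of t "\<phi> t"] mem[of t] that by simp
  qed
  with w0 have wT: "\<delta> * exp (- \<beta> * \<xi>) * exp (- (2 * B) * T) \<le> w T"
    by (smt (verit) mult_right_mono exp_ge_zero)
  \<comment> \<open>Were the distance always below \<open>r\<close>, it would grow at rate
    \<open>m\<close>; \<open>s\<close> is chosen so that \<open>1 + m * s \<le> exp (m * s)\<close>
    already lifts it to \<open>z T + r\<close>.\<close>
  have "\<exists>t\<ge>T. z t \<ge> r"
  proof (rule ccontr)
    assume "\<not> ?thesis"
    then have small: "z t < r" if "t \<ge> T" for t using that by force
    define m where "m = \<mu> * (1 - \<kappa>)"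
    have m: "m > 0" using \<mu> \<kappa> by (simp add: m_def)
    define s where "s = r / (z T * m)"
    have zT_pos: "z T > 0" using z_pos T by simp
    have s: "s > 0" using r zT_pos m by (simp add: s_def)
    have "z T * exp (m * (T + s - T)) \<le> z (T + s)"
      by (rule gronwall_ge[where z' = "\<lambda>t. u t (\<phi> t) - u t (p t)"])
        (use s T zc zd z'_ge small in \<open>auto simp: m_def\<close>)
    moreover have "z T * (1 + m * s) \<le> z T * exp (m * s)"
      using zT_pos exp_ge_add_one_self[of "m * s"] by (intro mult_left_mono) auto
    moreover have "z T * (1 + m * s) = z T + r"
      using zT_pos m by (simp add: s_def field_simps)
    ultimately show False using small[of "T + s"] s zT_pos by simp
  qed
  then obtain t1 where t1: "t1 \<ge> T" "z t1 \<ge> r" by blast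
  \<comment> \<open>The least element of this compact set is the first time from \<open>T\<close> on
    at which the distance is at least \<open>r\<close>.\<close>
  define K where "K = {t \<in> {T..t1}. r \<le> z t}"
  have "closed K" unfolding K_def
    by (intro continuous_on_closed_Collect_le continuous_on_const zc T) auto
  moreover have "bounded K" by (rule bounded_subset[of "{T..t1}"]) (auto simp: K_def)
  moreover have "t1 \<in> K" using t1 by (simp add: K_def)
  ultimately obtain t where t: "t \<in> K" "\<And>s. s \<in> K \<Longrightarrow> t \<le> s"
    using compact_attains_inf[of K] compact_eq_bounded_closed[of K] by auto
  have tT: "T \<le> t" and zt: "r \<le> z t" using t(1) by (auto simp: K_def)
  have before: "z s < r" if "T < s" "s < t" for s
    using t(2)[of s] t(1) that by (force simp: K_def)
  \<comment> \<open>Rescaled elapsed time: the growth of the distance to \<open>r\<close> bounds it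
    from below, the bound on \<open>a\<close> from above.\<close>
  define E where "E = \<mu> * (t - T)"
  have "z t \<le> z T * exp (\<mu> * (1 + \<kappa>) * (t - T))"
    by (rule gronwall_le[where z' = "\<lambda>t. u t (\<phi> t) - u t (p t)", OF tT])
      (use T zc zd z'_le before in auto)
  also have "\<dots> \<le> exp (- \<xi> + B * T) * exp (\<mu> * (1 + \<kappa>) * (t - T))"
    using zT by (intro mult_right_mono) auto
  also have "\<dots> = exp (- \<xi> + B * T + (1 + \<kappa>) * E)"
    by (simp add: E_def mult_ac flip: exp_add)
  finally have "r \<le> exp (- \<xi> + B * T + (1 + \<kappa>) * E)" using zt by linarith
  then have 1: "ln r \<le> - \<xi> + B * T + (1 + \<kappa>) * E"
    using r by (metis exp_gt_zero ln_exp ln_le_cancel_iff)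
  have "w T * exp (2 * \<mu> * (1 - \<kappa>) * (t - T)) \<le> w t"
    unfolding w_def
  proof (rule along_diff_lower[OF \<phi>(2) p(1) T tT less])
    fix s assume s: "T < s" "s < t"
    have "p s \<le> \<phi> s" using z_pos[of s] s T by (simp add: z_def)
    then show "2 * \<mu> * (1 - \<kappa>) \<le> a s (p s) + a s (\<phi> s)"
      using a_near[of s "p s"] a_near[of s "\<phi> s"] in_window[OF _ before[OF s], of "p s"]
        in_window[OF _ before[OF s], of "\<phi> s"] s by simp
  qed
  moreover have "w t \<le> 2 * B"
    using bd[of t "p t"] bd[of t "\<phi> t"] mem[of t] tT T by (simp add: w_def)
  \<comment> \<open>Passing to the exponential allows a comparison of exponents even if
    \<open>B = 0\<close>.\<close>
  moreover have "2 * B \<le> exp (2 * B)" using exp_ge_add_one_self[of "2 * B"] by linarith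
  moreover have "\<delta> * exp (- \<beta> * \<xi>) * exp (- (2 * B) * T) * exp (2 * \<mu> * (1 - \<kappa>) * (t - T))
      \<le> w T * exp (2 * \<mu> * (1 - \<kappa>) * (t - T))"
    using wT by (intro mult_right_mono) auto
  moreover have "\<delta> * exp (- \<beta> * \<xi>) * exp (- (2 * B) * T) * exp (2 * \<mu> * (1 - \<kappa>) * (t - T))
      = exp (ln \<delta> - \<beta> * \<xi> - 2 * B * T + 2 * (1 - \<kappa>) * E)"
    using \<delta> by (simp add: E_def exp_add exp_diff exp_minus field_simps)
  ultimately have "exp (ln \<delta> - \<beta> * \<xi> - 2 * B * T + 2 * (1 - \<kappa>) * E) \<le> exp (2 * B)" by linarith
  then have 2: "ln \<delta> - \<beta> * \<xi> - 2 * B * T - 2 * B + 2 * (1 - \<kappa>) * E \<le> 0" by simp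
  \<comment> \<open>The multipliers \<open>1 + \<kappa>\<close> and
    \<open>2 * (1 - \<kappa>)\<close> give \<open>E\<close> the same coefficient in both
    inequalities.\<close>
  have "(1 + \<kappa>) * (ln \<delta> - \<beta> * \<xi> - 2 * B * T - 2 * B) + 2 * (1 - \<kappa>) * ((1 + \<kappa>) * E) \<le> 0"
    using mult_left_mono[OF 2, of "1 + \<kappa>"] \<kappa> by (simp add: algebra_simps)
  moreover have "2 * (1 - \<kappa>) * (ln r + \<xi> - B * T) \<le> 2 * (1 - \<kappa>) * ((1 + \<kappa>) * E)"
    using 1 \<kappa> by (intro mult_left_mono) auto
  ultimately show ?thesis by linarith
qed

text \<open>For \<open>\<mu> > 0\<close> the quantities \<open>\<kappa>\<close>, \<open>r\<close>
  and \<open>T\<close> are fixed before \<open>\<xi>\<close>. Then \<open>escape_estimate\<close>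
  bounds an affine function of \<open>\<xi>\<close> from above; its slope is positive because
  \<open>\<beta> < 2\<close>, so a large \<open>\<xi>\<close> violates it.\<close>

lemma no_convergence:
  assumes conv: "\<And>e. e > 0 \<Longrightarrow> \<exists>T\<ge>0. \<forall>t\<ge>T. \<forall>x\<in>{-pi..pi}. \<bar>a t x - \<mu> * cos x\<bar> \<le> e"
    and \<mu>: "\<mu> \<noteq> 0" and \<beta>: "0 < \<beta>" "\<beta> < 2" and \<delta>: "\<delta> > 0"
    and max0: "\<And>x. x \<in> {-pi..pi} \<Longrightarrow> a0 x \<le> a0 0"
    and min_pi: "\<And>x. x \<in> {-pi..pi} \<Longrightarrow> a0 (-pi) \<le> a0 x"
    and gap: "\<And>x. 0 < x \<Longrightarrow> x \<le> pi \<Longrightarrow> \<delta> * x powr \<beta> \<le> a0 0 - a0 x"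
  shows False
proof (cases "\<mu> > 0")
  case False
  with \<mu> have neg: "\<mu> < 0" by simp
  then obtain T where T: "T \<ge> 0" "\<forall>t\<ge>T. \<forall>x\<in>{-pi..pi}. \<bar>a t x - \<mu> * cos x\<bar> \<le> - \<mu> / 2"
    using conv[of "- \<mu> / 2"] by auto
  \<comment> \<open>The minimum stays at \<open>-pi\<close>, whereas for negative
    \<open>\<mu>\<close> the limit profile is largest there.\<close>
  have "a T (-pi) \<le> a T 0"
    using min_along[OF characteristic_left T(1), of 0] min_pi by simp
  moreover have "\<bar>a T (-pi) + \<mu>\<bar> \<le> - \<mu> / 2" "\<bar>a T 0 - \<mu>\<bar> \<le> - \<mu> / 2"
    using T(2)[rule_format, of T "-pi"] T(2)[rule_format, of T 0] by auto
  ultimately show False using neg by linarith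
next
  case True
  \<comment> \<open>This choice makes the slope \<open>\<gamma>\<close> of the affine function equal
    to \<open>(2 - \<beta>) / 2\<close>.\<close>
  define \<kappa> where "\<kappa> = (2 - \<beta>) / (2 * (2 + \<beta>))"
  have \<kappa>: "0 < \<kappa>" "\<kappa> < 1" using \<beta> by (auto simp: \<kappa>_def field_simps)
  define \<gamma> where "\<gamma> = 2 * (1 - \<kappa>) - \<beta> * (1 + \<kappa>)"
  have "\<kappa> * (2 + \<beta>) = (2 - \<beta>) / 2" using \<beta> by (simp add: \<kappa>_def field_simps)
  then have \<gamma>: "\<gamma> > 0" using \<beta> by (simp add: \<gamma>_def algebra_simps)
  \<comment> \<open>The square of \<open>2 * r\<close> is \<open>\<kappa>\<close>, so the quadratic
    bound gives \<open>1 - \<kappa> / 2 \<le> cos x\<close> on the window.\<close>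
  define r where "r = sqrt \<kappa> / 2"
  have r: "0 < r" "r \<le> 1 / 2" "r\<^sup>2 = \<kappa> / 4"
    using \<kappa> by (auto simp: r_def power_divide)
  have rpi: "2 * r \<le> pi" using r pi_gt3 by linarith
  have cos_r: "cos r < 1" using cos_monotone_0_pi[of 0 r] r rpi by simp
  have cos_near: "1 - \<kappa> / 2 \<le> cos x" if "\<bar>x\<bar> \<le> 2 * r" for x
  proof -
    have "x\<^sup>2 \<le> (2 * r)\<^sup>2" using that r by (metis abs_le_square_iff abs_of_pos mult_pos_pos zero_less_numeral)
    then show ?thesis using cos_ge_quadratic[of x] r(3) by (simp add: power_mult_distrib)
  qed
  \<comment> \<open>The first bound uses up the other half of \<open>\<kappa>\<close> in
    \<open>a_near\<close>. The second allows for errors at both 0 and \<open>p t\<close>: a maximum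
    at \<open>p t\<close> then forces \<open>cos r \<le> cos (p t)\<close>.\<close>
  define \<eta> where "\<eta> = \<mu> * min (\<kappa> / 2) ((1 - cos r) / 2)"
  have \<eta>: "\<eta> > 0" "\<eta> \<le> \<mu> * (\<kappa> / 2)" "\<eta> \<le> \<mu> * ((1 - cos r) / 2)"
    unfolding \<eta>_def using True \<kappa> cos_r
    by (simp_all only: mult_le_cancel_left_pos min.cobounded1 min.cobounded2) simp
  obtain T where T: "T \<ge> 0"
      and near: "\<And>t x. t \<ge> T \<Longrightarrow> x \<in> {-pi..pi} \<Longrightarrow> \<bar>a t x - \<mu> * cos x\<bar> \<le> \<eta>"
    using conv[OF \<eta>(1)] by blast
  obtain p where p: "p 0 = 0" "\<And>T. characteristic T p"
    using characteristic_forward[of 0] by auto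
  have p_small: "\<bar>p t\<bar> \<le> r" if t: "t \<ge> T" for t
  proof -
    have pm: "p t \<in> {-pi..pi}" using characteristic_mem[OF p(2), of t t] t T by simp
    have "a t 0 \<le> a t (p t)"
      by (rule max_along[OF p(2)]) (use t T max0 p(1) in auto)
    then have "\<mu> * cos r \<le> \<mu> * cos (p t)"
      using near[OF t pm] near[OF t, of 0] \<eta>(3) by (simp add: algebra_simps)
    then have "cos r \<le> cos \<bar>p t\<bar>" using True by simp
    then show ?thesis using cos_mono_le_eq[of r "\<bar>p t\<bar>"] pm r rpi by auto
  qed
  have a_near: "\<mu> * (1 - \<kappa>) \<le> a t x \<and> a t x \<le> \<mu> * (1 + \<kappa>)" if "t \<ge> T" "\<bar>x\<bar> \<le> 2 * r" for t x
  proof -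
    have "\<mu> * (1 - \<kappa> / 2) \<le> \<mu> * cos x" "\<mu> * cos x \<le> \<mu> * 1"
      using cos_near[OF that(2)] True by (auto intro!: mult_left_mono)
    moreover have "\<mu> * \<kappa> > 0" using True \<kappa> by simp
    moreover have "x \<in> {-pi..pi}" using that(2) rpi by simp linarith
    then have "\<bar>a t x - \<mu> * cos x\<bar> \<le> \<eta>" by (rule near[OF that(1)])
    ultimately show ?thesis using \<eta>(2) by (auto simp: algebra_simps)
  qed
  \<comment> \<open>\<open>C\<close> collects the terms without \<open>\<xi>\<close>, and
    \<open>\<xi>\<close> is chosen so that \<open>\<gamma> * \<xi>\<close> exceeds
    \<open>\<bar>C\<bar>\<close>.\<close>
  define C where "C = (1 + \<kappa>) * (ln \<delta> - 2 * B * T - 2 * B) + 2 * (1 - \<kappa>) * (ln r - B * T)"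
  define \<xi> where "\<xi> = (\<bar>C\<bar> + 1) / \<gamma>"
  have \<xi>: "\<xi> \<ge> 0" "\<gamma> * \<xi> = \<bar>C\<bar> + 1" using \<gamma> by (auto simp: \<xi>_def)
  have "(1 + \<kappa>) * (ln \<delta> - \<beta> * \<xi> - 2 * B * T - 2 * B) + 2 * (1 - \<kappa>) * (ln r + \<xi> - B * T) \<le> 0"
  proof (rule escape_estimate[OF p(2,1) True \<kappa> r(1) rpi T p_small a_near \<delta> \<xi>(1)])
    have "exp (- \<xi>) \<le> pi" using \<xi>(1) pi_gt3 by (smt (verit) one_le_exp_iff exp_le_one_iff)
    then show "\<delta> * exp (- \<beta> * \<xi>) \<le> a0 0 - a0 (exp (- \<xi>))"
      using gap[of "exp (- \<xi>)"] by (simp add: powr_def)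
  qed
  then have "\<gamma> * \<xi> + C \<le> 0" by (simp add: \<gamma>_def C_def algebra_simps)
  then show False using \<xi>(2) by linarith
qed

end

section \<open>Hoelder regularity of the perturbation\<close>

text \<open>A fraction in [0,1] is at most its power with exponent \<open>\<gamma> \<le> 1\<close>;
  apply this to the two shares of \<open>x + y\<close>, which add up to 1.\<close>

lemma powr_add_le:
  fixes x y :: real
  assumes "0 \<le> x" "0 \<le> y" "0 \<le> \<gamma>" "\<gamma> \<le> 1"
  shows "(x + y) powr \<gamma> \<le> x powr \<gamma> + y powr \<gamma>"
proof (cases "x + y = 0")
  case False
  define s where "s = x + y"
  have s: "s > 0" using False assms by (simp add: s_def)
  have *: "s powr \<gamma> * (t / s) \<le> t powr \<gamma>" if "0 \<le> t" "t \<le> s" for t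
  proof -
    have "t / s \<le> (t / s) powr \<gamma>"
      using powr_mono'[of \<gamma> 1 "t / s"] that s assms by simp
    then have "s powr \<gamma> * (t / s) \<le> s powr \<gamma> * (t / s) powr \<gamma>"
      by (intro mult_left_mono) auto
    also have "\<dots> = t powr \<gamma>" using that s by (simp add: powr_divide)
    finally show ?thesis .
  qed
  have "x / s + y / s = 1" using s by (simp add: s_def flip: add_divide_distrib)
  then have "s powr \<gamma> = s powr \<gamma> * (x / s) + s powr \<gamma> * (y / s)"
    by (metis distrib_left mult.right_neutral)
  also have "\<dots> \<le> x powr \<gamma> + y powr \<gamma>"
    using *[of x] *[of y] assms by (simp add: s_def)
  finally show ?thesis by (simp add: s_def)
qed (use assms in auto)

text \<open>Needed for the derivative of \<open>\<bar>x\<bar> powr \<beta>\<close>. For equal signs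
  subadditivity suffices; for opposite signs each term is bounded separately, whence the factor
  2.\<close>

lemma signed_powr_hoelder:
  fixes x y :: real
  assumes "0 \<le> \<gamma>" "\<gamma> \<le> 1"
  shows "\<bar>sgn x * \<bar>x\<bar> powr \<gamma> - sgn y * \<bar>y\<bar> powr \<gamma>\<bar> \<le> 2 * \<bar>x - y\<bar> powr \<gamma>"
proof (induction x y rule: linorder_wlog)
  case (le x y)
  have sgn_pos: "sgn t * \<bar>t\<bar> powr \<gamma> = t powr \<gamma>" if "t \<ge> 0" for t :: real
    using that by (cases "t = 0") auto
  have sgn_neg: "sgn t * \<bar>t\<bar> powr \<gamma> = - ((- t) powr \<gamma>)" if "t \<le> 0" for t :: real
    using that by (cases "t = 0") auto
  have mono: "s powr \<gamma> \<le> t powr \<gamma>" if "0 \<le> s" "s \<le> t" for s t :: real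
    using that assms by (intro powr_mono2) auto
  consider "0 \<le> x" | "y \<le> 0" | "x < 0" "0 < y" by linarith
  then show ?case
  proof cases
    case 1
    then have "0 \<le> y" using le by simp
    show ?thesis
      unfolding sgn_pos[OF 1] sgn_pos[OF \<open>0 \<le> y\<close>]
      using 1 le powr_add_le[of x "y - x" \<gamma>] mono[of x y] assms
      by (simp add: abs_minus_commute[of x y])
  next
    case 2
    then have "x \<le> 0" using le by simp
    show ?thesis
      unfolding sgn_neg[OF 2] sgn_neg[OF \<open>x \<le> 0\<close>]
      using 2 le powr_add_le[of "- y" "y - x" \<gamma>] mono[of "- y" "- x"] assms
      by (simp add: abs_minus_commute[of x y])
  next
    case 3
    then have d: "\<bar>x - y\<bar> = y - x" by simp
    show ?thesis
      unfolding sgn_neg[OF less_imp_le[OF 3(1)]] sgn_pos[OF less_imp_le[OF 3(2)]] d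
      using 3 mono[of "- x" "y - x"] mono[of y "y - x"] powr_ge_zero[of "- x" \<gamma>] powr_ge_zero[of y \<gamma>]
      by linarith
  qed
next
  case (sym x y)
  then show ?case by (simp add: abs_minus_commute)
qed

text \<open>Lowers a Hoelder exponent on a set of diameter at most \<open>b\<close>; as the exponent
  drops by at most 1, the constant is \<open>b\<close> itself.\<close>

lemma powr_le_const_mult_powr:
  fixes d :: real
  assumes "0 < d" "d \<le> b" "1 \<le> b" "\<alpha> \<le> \<gamma>" "\<gamma> - \<alpha> \<le> 1"
  shows "d powr \<gamma> \<le> b * d powr \<alpha>"
proof -
  have "d powr \<gamma> = d powr (\<gamma> - \<alpha>) * d powr \<alpha>" by (simp flip: powr_add)
  also have "d powr (\<gamma> - \<alpha>) \<le> b powr (\<gamma> - \<alpha>)" using assms by (intro powr_mono2) auto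
  also have "b powr (\<gamma> - \<alpha>) \<le> b powr 1" using assms by (intro powr_mono) auto
  finally show ?thesis using assms by (simp add: mult_right_mono)
qed

lemma has_real_derivative_abs_powr:
  fixes x :: real
  assumes "\<beta> > 1"
  shows "((\<lambda>x. \<bar>x\<bar> powr \<beta>) has_real_derivative \<beta> * (sgn x * \<bar>x\<bar> powr (\<beta> - 1))) (at x)"
proof (cases "x = 0")
  case True
  \<comment> \<open>At 0 the difference quotient has absolute value
    \<open>\<bar>h\<bar> powr (\<beta> - 1)\<close>, which tends to 0 since
    \<open>\<beta> > 1\<close>.\<close>
  have "((\<lambda>h. \<bar>h\<bar> powr \<beta> / h) \<longlongrightarrow> 0) (at (0 :: real))"
  proof (rule Lim_null_comparison)
    show "\<forall>\<^sub>F h in at (0 :: real). norm (\<bar>h\<bar> powr \<beta> / h) \<le> \<bar>h\<bar> powr (\<beta> - 1)"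
      by (auto simp: eventually_at powr_diff intro!: exI[of _ 1])
    have "((\<lambda>h::real. \<bar>h\<bar> powr (\<beta> - 1)) \<longlongrightarrow> \<bar>0\<bar> powr (\<beta> - 1)) (at 0)"
      using assms by (intro tendsto_powr' tendsto_intros) auto
    then show "((\<lambda>h::real. \<bar>h\<bar> powr (\<beta> - 1)) \<longlongrightarrow> 0) (at 0)" by simp
  qed
  then show ?thesis using True by (simp add: DERIV_def)
next
  case False
  then consider "x > 0" | "x < 0" by linarith
  then show ?thesis
  proof cases
    case 1
    then have "((\<lambda>x. x powr \<beta>) has_real_derivative \<beta> * (sgn x * \<bar>x\<bar> powr (\<beta> - 1))) (at x)"
      by (auto intro!: derivative_eq_intros)
    then show ?thesis
      by (rule has_field_derivative_transform_within_open[of _ _ _ "{0<..}"]) (use 1 in auto)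
  next
    case 2
    then have "((\<lambda>x. (- x) powr \<beta>) has_real_derivative \<beta> * (sgn x * \<bar>x\<bar> powr (\<beta> - 1))) (at x)"
      by (auto intro!: derivative_eq_intros simp: powr_diff)
    then show ?thesis
      by (rule has_field_derivative_transform_within_open[of _ _ _ "{..<0}"]) (use 2 in auto)
  qed
qed

lemma hoelder_norm_le_scale:
  assumes "hoelder_norm_le s f c" "k \<ge> 0"
  shows "hoelder_norm_le s (\<lambda>x. k * f x) (k * c)"
proof -
  let ?n = "hoelder_order s" and ?\<alpha> = "hoelder_exponent s"
  obtain D M H where D: "\<forall>x\<in>{-pi..pi}. D 0 x = f x"
      "\<forall>j<?n. \<forall>x\<in>{-pi..pi}. (D j has_real_derivative D (Suc j) x) (at x within {-pi..pi})"
      "continuous_on {-pi..pi} (D ?n)"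
      "\<forall>j\<le>?n. \<forall>x\<in>{-pi..pi}. \<bar>D j x\<bar> \<le> M j"
      "\<forall>x\<in>{-pi..pi}. \<forall>y\<in>{-pi..pi}. x \<noteq> y \<longrightarrow> \<bar>D ?n x - D ?n y\<bar> \<le> H * \<bar>x - y\<bar> powr ?\<alpha>"
      "(\<Sum>j\<le>?n. M j) + H \<le> c"
    using assms(1) unfolding hoelder_norm_le_def Let_def by blast
  have "(\<Sum>j\<le>?n. k * M j) + k * H = k * ((\<Sum>j\<le>?n. M j) + H)"
    by (simp add: sum_distrib_left distrib_left)
  then have "(\<Sum>j\<le>?n. k * M j) + k * H \<le> k * c"
    using mult_left_mono[OF D(6) assms(2)] by simp
  moreover have "\<bar>k * D ?n x - k * D ?n y\<bar> \<le> k * H * \<bar>x - y\<bar> powr ?\<alpha>"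
    if "x \<in> {-pi..pi}" "y \<in> {-pi..pi}" "x \<noteq> y" for x y
    using mult_left_mono[OF D(5)[rule_format, OF that] assms(2)] assms(2)
    by (simp add: abs_mult mult.assoc flip: right_diff_distrib)
  ultimately show ?thesis
    unfolding hoelder_norm_le_def Let_def
    using D(1-4) assms(2)
    by (intro exI[of _ "\<lambda>j x. k * D j x"] exI[of _ "\<lambda>j. k * M j"] exI[of _ "k * H"])
      (auto intro!: continuous_intros DERIV_cmult mult_left_mono simp: abs_mult)
qed

text \<open>The lower bound 3/2 keeps \<open>\<beta> > 1\<close> for every \<open>s\<close>, so the
  function is continuously differentiable with a Hoelder derivative of exponent
  \<open>\<beta> - 1\<close>. If \<open>s \<ge> 1\<close> this exponent is lowered to
  \<open>s - 1\<close>; otherwise the Lipschitz bound is lowered.\<close>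

lemma hoelder_norm_le_abs_powr:
  assumes "s < 2" "\<beta> = max s (3 / 2)"
  obtains C where "C > 0" "hoelder_norm_le s (\<lambda>x. m - \<bar>x\<bar> powr \<beta>) C"
proof -
  have \<beta>: "1 < \<beta>" "\<beta> < 2" "s \<le> \<beta>" using assms by auto
  define f where "f x = m - \<bar>x\<bar> powr \<beta>" for x :: real
  define g where "g x = - \<beta> * (sgn x * \<bar>x\<bar> powr (\<beta> - 1))" for x :: real
  have fd: "(f has_real_derivative g x) (at x within S)" for x S
    unfolding f_def g_def
    by (rule has_field_derivative_at_within,
        rule DERIV_diff[OF DERIV_const has_real_derivative_abs_powr[OF \<beta>(1)], THEN DERIV_cong]) simp
  define L where "L = \<beta> * pi powr (\<beta> - 1)"
  have L: "L > 0" using \<beta> by (simp add: L_def)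
  have g_bd: "\<bar>g x\<bar> \<le> L" if "x \<in> {-pi..pi}" for x
  proof -
    have "\<bar>g x\<bar> \<le> \<beta> * \<bar>x\<bar> powr (\<beta> - 1)"
      using \<beta> by (auto simp: g_def abs_mult sgn_if)
    also have "\<dots> \<le> L" unfolding L_def using \<beta> that by (intro mult_left_mono powr_mono2) auto
    finally show ?thesis .
  qed
  have g_h: "\<bar>g x - g y\<bar> \<le> 2 * \<beta> * \<bar>x - y\<bar> powr (\<beta> - 1)" for x y
  proof -
    have "\<bar>g x - g y\<bar> = \<beta> * \<bar>sgn x * \<bar>x\<bar> powr (\<beta> - 1) - sgn y * \<bar>y\<bar> powr (\<beta> - 1)\<bar>"
    proof -
      have "g x - g y = - \<beta> * (sgn x * \<bar>x\<bar> powr (\<beta> - 1) - sgn y * \<bar>y\<bar> powr (\<beta> - 1))"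
        by (simp add: g_def algebra_simps)
      then show ?thesis using \<beta> by (simp add: abs_mult)
    qed
    also have "\<dots> \<le> \<beta> * (2 * \<bar>x - y\<bar> powr (\<beta> - 1))"
      using \<beta> by (intro mult_left_mono signed_powr_hoelder) auto
    finally show ?thesis by simp
  qed
  have f_bd: "\<bar>f x\<bar> \<le> \<bar>m\<bar> + pi powr \<beta>" if "x \<in> {-pi..pi}" for x
  proof -
    have "\<bar>x\<bar> powr \<beta> \<le> pi powr \<beta>" using \<beta> that by (intro powr_mono2) auto
    moreover have "\<bar>x\<bar> powr \<beta> \<ge> 0" by simp
    ultimately show ?thesis unfolding f_def by linarith
  qed
  have f_h: "\<bar>f x - f y\<bar> \<le> L * \<bar>x - y\<bar>" if "x \<in> {-pi..pi}" "y \<in> {-pi..pi}" for x y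
    using field_differentiable_bound[of "{-pi..pi}" f g L x y] fd g_bd that by (simp add: abs_minus_commute)
  have fc: "continuous_on {-pi..pi} f"
    unfolding continuous_on_eq_continuous_within by (blast intro: DERIV_continuous fd)
  have gc: "continuous_on {-pi..pi} g"
  proof -
    have "continuous_on UNIV (\<lambda>x::real. sgn x * \<bar>x\<bar> powr (\<beta> - 1))"
    proof (rule continuous_at_imp_continuous_on, intro ballI)
      fix x :: real
      have "((\<lambda>y. 2 * \<bar>y - x\<bar> powr (\<beta> - 1)) \<longlongrightarrow> 2 * \<bar>x - x\<bar> powr (\<beta> - 1)) (at x)"
        using \<beta> by (intro tendsto_powr' tendsto_intros) auto
      then have lim0: "((\<lambda>y. 2 * \<bar>y - x\<bar> powr (\<beta> - 1)) \<longlongrightarrow> 0) (at x)"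
        by simp
      have "norm (sgn y * \<bar>y\<bar> powr (\<beta> - 1) - sgn x * \<bar>x\<bar> powr (\<beta> - 1))
          \<le> 2 * \<bar>y - x\<bar> powr (\<beta> - 1)" for y
        unfolding real_norm_def by (rule signed_powr_hoelder) (use \<beta> in auto)
      then have "((\<lambda>y. sgn y * \<bar>y\<bar> powr (\<beta> - 1) - sgn x * \<bar>x\<bar> powr (\<beta> - 1)) \<longlongrightarrow> 0) (at x)"
        by (intro Lim_null_comparison[OF always_eventually lim0] allI)
      then show "isCont (\<lambda>x. sgn x * \<bar>x\<bar> powr (\<beta> - 1)) x"
        unfolding isCont_def by (rule LIM_zero_cancel)
    qed
    then show ?thesis
      unfolding g_def by (rule continuous_on_mult_left[OF continuous_on_subset]) simp
  qed
  \<comment> \<open>7 exceeds the length of the interval.\<close>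
  have dist7: "\<bar>x - y\<bar> \<le> 7" if "x \<in> {-pi..pi}" "y \<in> {-pi..pi}" for x y :: real
    using that pi_less_4 pi_approx by auto
  \<comment> \<open>One constant for both cases: bounds on the function and its derivative, then the
    Hoelder constants \<open>14 * \<beta>\<close> of the derivative and \<open>7 * L\<close> of the
    function.\<close>
  define C where "C = (\<bar>m\<bar> + pi powr \<beta>) + L + 14 * \<beta> + 7 * L"
  have "C > 0" using L \<beta> by (simp add: C_def add_nonneg_pos)
  moreover have "hoelder_norm_le s f C"
  proof (cases "s \<ge> 1")
    case True
    have "\<lfloor>s\<rfloor> = 1" using True assms by linarith
    then have k: "hoelder_order s = Suc 0" by (simp add: hoelder_order_def)
    then have \<alpha>: "hoelder_exponent s = s - 1" using True by (simp add: hoelder_exponent_def)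
    have "\<bar>g x - g y\<bar> \<le> 14 * \<beta> * \<bar>x - y\<bar> powr (s - 1)"
      if "x \<in> {-pi..pi}" "y \<in> {-pi..pi}" "x \<noteq> y" for x y
    proof -
      have "\<bar>x - y\<bar> powr (\<beta> - 1) \<le> 7 * \<bar>x - y\<bar> powr (s - 1)"
        using that dist7[OF that(1,2)] \<beta> True by (intro powr_le_const_mult_powr) auto
      then have "2 * \<beta> * \<bar>x - y\<bar> powr (\<beta> - 1) \<le> 2 * \<beta> * (7 * \<bar>x - y\<bar> powr (s - 1))"
        using \<beta> by (intro mult_left_mono) auto
      then show ?thesis using g_h[of x y] by simp
    qed
    then show ?thesis
      unfolding hoelder_norm_le_def Let_def k \<alpha>
      using fd gc f_bd g_bd L
      by (intro exI[of _ "\<lambda>j. if j = 0 then f else g"]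
          exI[of _ "\<lambda>j. if j = 0 then \<bar>m\<bar> + pi powr \<beta> else L"] exI[of _ "14 * \<beta>"])
        (auto simp: C_def le_Suc_eq)
  next
    case False
    have k: "hoelder_order s = 0" using False by (simp add: hoelder_order_def floor_le_iff)
    define \<alpha> where "\<alpha> = hoelder_exponent s"
    have \<alpha>: "0 \<le> \<alpha>" "\<alpha> < 1" using k False by (auto simp: hoelder_exponent_def \<alpha>_def)
    have "\<bar>f x - f y\<bar> \<le> 7 * L * \<bar>x - y\<bar> powr \<alpha>"
      if "x \<in> {-pi..pi}" "y \<in> {-pi..pi}" "x \<noteq> y" for x y
    proof -
      have "\<bar>x - y\<bar> powr 1 \<le> 7 * \<bar>x - y\<bar> powr \<alpha>"
        using that dist7[OF that(1,2)] \<alpha> by (intro powr_le_const_mult_powr) auto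
      then have "L * \<bar>x - y\<bar> \<le> L * (7 * \<bar>x - y\<bar> powr \<alpha>)"
        using L by (intro mult_left_mono) auto
      then show ?thesis using f_h[OF that(1,2)] by simp
    qed
    then show ?thesis
      unfolding hoelder_norm_le_def Let_def k \<alpha>_def[symmetric]
      using fc f_bd L \<beta>
      by (intro exI[of _ "\<lambda>j. f"] exI[of _ "\<lambda>j. \<bar>m\<bar> + pi powr \<beta>"] exI[of _ "7 * L"])
        (auto simp: C_def)
  qed
  ultimately show thesis using that unfolding f_def by blast
qed

section \<open>Absence of convergence\<close>

text \<open>A real \<open>SUP\<close> dominates the individual values only over a set bounded above;
  continuity on the compact interval ensures this.\<close>

lemma global_solution_uniform_convergence:
  assumes sol: "global_solution a a0"
    and lim: "((\<lambda>t. SUP x\<in>{-pi..pi}. \<bar>a t x - \<mu> * cos x\<bar>) \<longlongrightarrow> 0) at_top" and e: "e > 0"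
  obtains T where "T \<ge> 0" "\<And>t x. t \<ge> T \<Longrightarrow> x \<in> {-pi..pi} \<Longrightarrow> \<bar>a t x - \<mu> * cos x\<bar> \<le> e"
proof -
  have ac: "continuous_on ({0..} \<times> {-pi..pi}) (\<lambda>(t, x). a t x)"
    using sol by (simp add: global_solution_def)
  obtain T where T: "\<And>t. t \<ge> T \<Longrightarrow> \<bar>SUP x\<in>{-pi..pi}. \<bar>a t x - \<mu> * cos x\<bar>\<bar> < e"
    using tendstoD[OF lim e] by (auto simp: eventually_at_top_linorder)
  show thesis
  proof (rule that[of "max 0 T"])
    fix t x :: real assume t: "t \<ge> max 0 T" and x: "x \<in> {-pi..pi}"
    have "continuous_on {-pi..pi} (\<lambda>x. (\<lambda>(t, x). a t x) (t, x))"
      by (rule continuous_on_compose2[OF ac]) (use t in \<open>auto intro!: continuous_intros\<close>)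
    then have "continuous_on {-pi..pi} (\<lambda>x. \<bar>a t x - \<mu> * cos x\<bar>)"
      by (auto intro!: continuous_intros)
    then have "bdd_above ((\<lambda>x. \<bar>a t x - \<mu> * cos x\<bar>) ` {-pi..pi})"
      by (intro bounded_imp_bdd_above compact_imp_bounded compact_continuous_image) auto
    from cSUP_upper[OF x this] T[of t] t show "\<bar>a t x - \<mu> * cos x\<bar> \<le> e" by simp
  qed simp
qed

text \<open>Compactness bounds \<open>a\<close> up to some time \<open>T\<close>; afterwards it is
  within 1 of \<open>\<mu> * cos\<close>.\<close>

lemma global_solution_bounded:
  assumes sol: "global_solution a a0"
    and lim: "((\<lambda>t. SUP x\<in>{-pi..pi}. \<bar>a t x - \<mu> * cos x\<bar>) \<longlongrightarrow> 0) at_top"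
  obtains B where "\<And>t x. t \<ge> 0 \<Longrightarrow> x \<in> {-pi..pi} \<Longrightarrow> \<bar>a t x\<bar> \<le> B"
proof -
  have ac: "continuous_on ({0..} \<times> {-pi..pi}) (\<lambda>(t, x). a t x)"
    using sol by (simp add: global_solution_def)
  obtain T where T: "T \<ge> 0" "\<And>t x. t \<ge> T \<Longrightarrow> x \<in> {-pi..pi} \<Longrightarrow> \<bar>a t x - \<mu> * cos x\<bar> \<le> 1"
    using global_solution_uniform_convergence[OF sol lim zero_less_one] by metis
  have "compact ((\<lambda>(t, x). a t x) ` ({0..T} \<times> {-pi..pi}))"
    by (intro compact_continuous_image continuous_on_subset[OF ac] compact_Times) auto
  then obtain B where B: "\<And>t x. t \<in> {0..T} \<Longrightarrow> x \<in> {-pi..pi} \<Longrightarrow> \<bar>a t x\<bar> \<le> B"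
    by (force dest!: compact_imp_bounded simp: bounded_iff)
  show thesis
  proof (rule that[of "max B (\<bar>\<mu>\<bar> + 1)"])
    fix t x :: real assume t: "t \<ge> 0" and x: "x \<in> {-pi..pi}"
    have "\<bar>\<mu> * cos x\<bar> \<le> \<bar>\<mu>\<bar> * 1"
      unfolding abs_mult by (intro mult_left_mono) auto
    then show "\<bar>a t x\<bar> \<le> max B (\<bar>\<mu>\<bar> + 1)"
      using B[of t x] T(2)[of t x] t x by (cases "t \<le> T") (auto simp: le_max_iff_disj)
  qed
qed

theorem theorem1p5:
  fixes \<epsilon> \<sigma> :: real
  assumes "\<epsilon> > 0" and "\<sigma> > 0"
  shows "\<exists>a0 :: real \<Rightarrow> real.
           integral {-pi..pi} a0 = 0 \<and>
           hoelder_norm_le (2 - \<epsilon>) (\<lambda>x. a0 x - cos x) \<sigma> \<and>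
           (\<forall>\<mu>::real. \<mu> \<noteq> 0 \<longrightarrow>
              \<not> (\<exists>a. global_solution a a0 \<and>
                   ((\<lambda>t. SUP x\<in>{-pi..pi}. \<bar>a t x - \<mu> * cos x\<bar>) \<longlongrightarrow> 0) at_top))"
proof -
  \<comment> \<open>At least \<open>2 - \<epsilon>\<close> for the required regularity, above 1 for
    differentiability, and below 2 for the escape argument.\<close>
  define \<beta> where "\<beta> = max (2 - \<epsilon>) (3 / 2)"
  have \<beta>: "0 < \<beta>" "\<beta> < 2" using assms by (auto simp: \<beta>_def)
  \<comment> \<open>The average of \<open>\<bar>x\<bar> powr \<beta>\<close>, which gives the
    perturbation zero mean; the factor \<open>k\<close> below then scales its norm bound to
    \<open>\<sigma>\<close>.\<close>
  define m where "m = integral {-pi..pi} (\<lambda>x. \<bar>x\<bar> powr \<beta>) / (2 * pi)"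
  obtain C where C: "C > 0" "hoelder_norm_le (2 - \<epsilon>) (\<lambda>x. m - \<bar>x\<bar> powr \<beta>) C"
    using hoelder_norm_le_abs_powr[of "2 - \<epsilon>" \<beta> m] assms by (auto simp: \<beta>_def)
  define k where "k = \<sigma> / C"
  have k: "k > 0" "k * C = \<sigma>" using assms C by (auto simp: k_def)
  define a0 where "a0 x = cos x + k * (m - \<bar>x\<bar> powr \<beta>)" for x :: real
  have powr_int: "(\<lambda>x. \<bar>x\<bar> powr \<beta>) integrable_on {-pi..pi}"
    using \<beta> by (intro integrable_continuous_real continuous_on_powr' continuous_intros) auto
  have cos_int: "(cos has_integral sin pi - sin (- pi)) {-pi..pi}"
    by (rule fundamental_theorem_of_calculus)
      (auto intro!: derivative_eq_intros simp flip: has_real_derivative_iff_has_vector_derivative)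
  have "(a0 has_integral (sin pi - sin (- pi)) +
      k * (m * (pi - - pi) - integral {-pi..pi} (\<lambda>x. \<bar>x\<bar> powr \<beta>))) {-pi..pi}"
    unfolding a0_def
    by (intro has_integral_add cos_int has_integral_mult_right has_integral_diff
        integrable_integral powr_int)
      (use has_integral_const_real[of m "-pi" pi] in \<open>simp add: mult.commute\<close>)
  then have "integral {-pi..pi} a0 = 0"
    by (auto dest!: integral_unique simp: m_def)
  moreover have "hoelder_norm_le (2 - \<epsilon>) (\<lambda>x. a0 x - cos x) \<sigma>"
    using hoelder_norm_le_scale[OF C(2), of k] k by (simp add: a0_def)
  moreover have False
    if "\<mu> \<noteq> 0" and sol: "global_solution a a0"
      and lim: "((\<lambda>t. SUP x\<in>{-pi..pi}. \<bar>a t x - \<mu> * cos x\<bar>) \<longlongrightarrow> 0) at_top" for a \<mu>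
  proof -
    obtain B where B: "\<And>t x. t \<ge> 0 \<Longrightarrow> x \<in> {-pi..pi} \<Longrightarrow> \<bar>a t x\<bar> \<le> B"
      using global_solution_bounded[OF sol lim] by metis
    interpret bounded_solution a a0 B by unfold_locales (fact sol B)+
    show False
    proof (rule no_convergence[OF _ \<open>\<mu> \<noteq> 0\<close> \<beta> k(1)])
      show "\<exists>T\<ge>0. \<forall>t\<ge>T. \<forall>x\<in>{-pi..pi}. \<bar>a t x - \<mu> * cos x\<bar> \<le> e" if "e > 0" for e
        using global_solution_uniform_convergence[OF sol lim that] by metis
      \<comment> \<open>Both \<open>cos\<close> and the perturbation are largest at 0 and smallest
        at \<open>-pi\<close> and \<open>pi\<close>, so no cancellation occurs in the three bounds
        that follow.\<close>
      show "a0 x \<le> a0 0" for x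
      proof -
        have "0 \<le> k * \<bar>x\<bar> powr \<beta>" using k by simp
        then have "cos x - k * \<bar>x\<bar> powr \<beta> \<le> 1" using cos_le_one[of x] by linarith
        then show ?thesis by (simp add: a0_def right_diff_distrib)
      qed
      show "a0 (-pi) \<le> a0 x" if "x \<in> {-pi..pi}" for x
      proof -
        have "k * \<bar>x\<bar> powr \<beta> \<le> k * pi powr \<beta>"
          using k \<beta> that by (intro mult_left_mono powr_mono2) auto
        then have "- 1 - k * pi powr \<beta> \<le> cos x - k * \<bar>x\<bar> powr \<beta>"
          using cos_ge_minus_one[of x] by linarith
        then show ?thesis by (simp add: a0_def right_diff_distrib)
      qed
      show "k * x powr \<beta> \<le> a0 0 - a0 x" if "0 < x" "x \<le> pi" for x
        using that cos_le_one[of x] by (simp add: a0_def right_diff_distrib)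
    qed
  qed
  ultimately show ?thesis by blast
qed

end
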